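(* There exists a smooth Pfaffian cubic fourfold $Y$, defined over $\mathbb{Q}$, containing no plane, which is the (cyclic) triple cover of $\mathbb{P}^4$ along a smooth Pfaffian cubic threefold $C$, and whose dual K3 surface $\Sigma$ is smooth and contains no line.
   Context: Let $V$ be a $6$-dimensional rational vector space; $\mathbb{P}(-)$ denotes the projective space of lines. The Pfaffian locus in $\mathbb{P}(\wedge^2V^* )$ is the cubic hypersurface $\mathrm{Pf}$ of degenerate skew-symmetric $2$-forms. Given a flag $Z\subset W\subset\wedge^2V^*$ of subspaces with $\dim Z=5$, $\dim W=6$, one associates to it the Pfaffian cubic threefold $C:=\mathrm{Pf}\cap\mathbb{P}(Z)$ in $\mathbb{P}(Z)\cong\mathbb{P}^4$ and the Pfaffian cubic fourfold $Y:=\mathrm{Pf}\cap\mathbb{P}(W)$ in $\mathbb{P}(W)\cong\mathbb{P}^5$. Let $W^\circ\subset\wedge^2V$ be the $9$-dimensional annihilator of $W$. The Grassmannian $\mathrm{Grass}(2,V)$ is viewed, by the Plücker embedding, as the subvariety of decomposable tensors in $\mathbb{P}(\wedge^2V)$. The dual K3 surface of $Y$ is $\Sigma:=\mathrm{Grass}(2,V)\cap\mathbb{P}(W^\circ)$; lines on $\Sigma$ are lines of $\mathbb{P}(W^\circ)$ contained in $\Sigma$. Smoothness and absence of planes and lines are understood over $\mathbb{C}$. The triple cover of $\mathbb{P}^4$ along $C$ is the cyclic triple cover ramified over $C$: if $f(x_0,\dots,x_4)=0$ is an equation of $C$, it is the cubic fourfold $f(x_0,\dots,x_4)+x_5^3=0$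 in $\mathbb{P}^5$. *)

theory Defs
  imports "HOL-Analysis.Analysis"
begin

section \<open>Two-forms, bivectors and the Pfaffian\<close>

text \<open>
  V is the standard 6-dimensional space with basis indexed by the type 6, whose elements are
  0, 1, 2, 3, 4, 5. Elements of both exterior squares are stored as skew-symmetric arrays:
  a form \<open>\<omega>\<close> by its values \<open>\<omega> $ (i, j) = \<omega>(e\<^sub>i, e\<^sub>j)\<close>, a bivector by its coordinates as a skew
  tensor, so that the bivector of v and w has (i, j) entry \<open>v\<^sub>i w\<^sub>j - v\<^sub>j w\<^sub>i\<close>.
\<close>

type_synonym 'a array6 = "'a ^ (6 \<times> 6)"

definition skew :: "'a::field_char_0 array6 set" where
  "skew = {a. \<forall>i j. a $ (i, j) = - a $ (j, i)}"

definition wedge :: "'a::field_char_0 ^ 6 \<Rightarrow> 'a ^ 6 \<Rightarrow> 'a array6" where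
  "wedge v w = (\<chi> p. v $ fst p * w $ snd p - v $ snd p * w $ fst p)"

definition decomposable :: "'a::field_char_0 array6 \<Rightarrow> bool" where
  "decomposable b \<longleftrightarrow> (\<exists>v w. b = wedge v w)"

definition degenerate :: "'a::field_char_0 array6 \<Rightarrow> bool" where
  "degenerate \<omega> \<longleftrightarrow> (\<exists>v :: 'a ^ 6. v \<noteq> 0
      \<and> (\<forall>j. (\<Sum>i\<in>UNIV. v $ i * \<omega> $ (i, j)) = 0))"

text \<open>The Pfaffian of the 4 by 4 skew block on the indices i, j, k, l, and the Pfaffian of the
  whole array by expansion along the first row.\<close>

definition pf4 :: "'a::field_char_0 array6 \<Rightarrow> 6 \<Rightarrow> 6 \<Rightarrow> 6 \<Rightarrow> 6 \<Rightarrow> 'a" where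
  "pf4 a i j k l = a $ (i, j) * a $ (k, l) - a $ (i, k) * a $ (j, l) + a $ (i, l) * a $ (j, k)"

definition pf :: "'a::field_char_0 array6 \<Rightarrow> 'a" where
  "pf a = a $ (0, 1) * pf4 a 2 3 4 5 - a $ (0, 2) * pf4 a 1 3 4 5 + a $ (0, 3) * pf4 a 1 2 4 5
        - a $ (0, 4) * pf4 a 1 2 3 5 + a $ (0, 5) * pf4 a 1 2 3 4"

text \<open>The Pluecker quadrics; with degenerate index quadruples they vanish on skew arrays.\<close>

definition pluecker_quadrics :: "('a::field_char_0 array6 \<Rightarrow> 'a) set" where
  "pluecker_quadrics = {\<lambda>b. pf4 b i j k l | i j k l. True}"

text \<open>Twice the natural pairing of a form with a bivector is the full sum below; the factor does
  not affect annihilators.\<close>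

definition annihilator :: "'a::field_char_0 array6 set \<Rightarrow> 'a array6 set" where
  "annihilator W = {b \<in> skew. \<forall>\<omega>\<in>W. (\<Sum>p\<in>UNIV. \<omega> $ p * b $ p) = 0}"

subsection \<open>The equations cut out the intended loci\<close>

lemma UNIV_6: "(UNIV :: 6 set) = {0, 1, 2, 3, 4, 5}"
proof -
  have "card {0, 1, 2, 3, 4, 5 :: 6} = 6" by simp
  then have "card {0, 1, 2, 3, 4, 5 :: 6} = card (UNIV :: 6 set)" by simp
  then show ?thesis
    using card_subset_eq[of UNIV "{0, 1, 2, 3, 4, 5 :: 6}"] by simp
qed

lemma all_6: "(\<forall>i::6. P i) \<longleftrightarrow> P 0 \<and> P 1 \<and> P 2
    \<and> P 3 \<and> P 4 \<and> P 5"
proof -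
  have "(\<forall>i::6. P i) \<longleftrightarrow> (\<forall>i\<in>{0, 1, 2, 3, 4, 5 :: 6}. P i)"
    unfolding UNIV_6[symmetric] by simp
  then show ?thesis by simp
qed

lemma sum_6: "(\<Sum>i\<in>UNIV. f (i::6)) = f 0 + f 1 + f 2 + f 3 + f 4 + f 5"
  unfolding UNIV_6 by (simp add: add.assoc)

lemma skewD: "a \<in> skew \<Longrightarrow> a $ (i, j) = - a $ (j, i)"
  unfolding skew_def by blast

lemma skew_diag:
  assumes "a \<in> skew"
  shows "a $ (i, i) = (0 :: 'a::field_char_0)"
proof -
  have "a $ (i, i) + a $ (i, i) = 0"
    by (subst skewD[OF assms]) (rule left_minus)
  then have "2 * a $ (i, i) = 0" by (simp only: mult_2)
  then show ?thesis by simp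
qed

lemma decomposable_iff_pluecker:
  fixes b :: "'a::field_char_0 array6"
  assumes "b \<in> skew"
  shows "decomposable b \<longleftrightarrow> (\<forall>F\<in>pluecker_quadrics. F b = 0)"
proof
  assume "decomposable b"
  then obtain v w where b: "b = wedge v w" by (auto simp: decomposable_def)
  have "pf4 b i j k l = 0" for i j k l
    by (simp add: b wedge_def pf4_def algebra_simps)
  then show "\<forall>F\<in>pluecker_quadrics. F b = 0" by (auto simp: pluecker_quadrics_def)
next
  assume "\<forall>F\<in>pluecker_quadrics. F b = 0"
  then have q: "pf4 b i j k l = 0" for i j k l
    by (rule bspec) (auto simp: pluecker_quadrics_def)
  show "decomposable b"
  proof (cases "b = 0")
    case True
    then have "b = wedge 0 0" by (simp add: wedge_def vec_eq_iff)
    then show ?thesis by (auto simp: decomposable_def)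
  next
    case False
    then obtain i j where ij: "b $ (i, j) \<noteq> 0" by (auto simp: vec_eq_iff)
    have eq: "b $ (k, l) * b $ (i, j) = b $ (i, k) * b $ (j, l) - b $ (i, l) * b $ (j, k)" for k l
      using q[of i j k l] by (simp add: pf4_def algebra_simps)
    have eq2: "b $ (k, l) = b $ (i, k) * (b $ (j, l) / b $ (i, j))
                          - b $ (i, l) * (b $ (j, k) / b $ (i, j))" for k l
      using ij eq[of k l] by (simp add: field_simps)
    have "b = wedge (\<chi> k. b $ (i, k)) (\<chi> k. b $ (j, k) / b $ (i, j))" (is "_ = ?r")
    proof -
      have "b $ p = ?r $ p" for p
        using eq2[of "fst p" "snd p"] unfolding wedge_def vec_lambda_beta prod.collapse .
      then show ?thesis unfolding vec_eq_iff ..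
    qed
    then show ?thesis by (auto simp: decomposable_def)
  qed
qed

lemma degenerate_6:
  "degenerate a \<longleftrightarrow> (\<exists>c0 c1 c2 c3 c4 c5. (c0 \<noteq> 0 \<or> c1 \<noteq> 0 \<or> c2 \<noteq> 0 \<or> c3 \<noteq> 0 \<or> c4 \<noteq> 0 \<or> c5 \<noteq> 0) \<and>
     (\<forall>j. c0 * a $ (0, j) + c1 * a $ (1, j) + c2 * a $ (2, j) + c3 * a $ (3, j)
         + c4 * a $ (4, j)
        + c5 * a $ (5, j) = 0))"  (is "?L \<longleftrightarrow> ?R")
proof
  assume ?L
  then obtain v :: "'a ^ 6" where "v \<noteq> 0" and v: "\<forall>j. (\<Sum>i\<in>UNIV. v $ i * a $ (i, j)) = 0"
    unfolding degenerate_def by blast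
  then have "\<not> (\<forall>i. v $ i = 0)" by (simp add: vec_eq_iff)
  then show ?R using v unfolding sum_6 all_6[of "\<lambda>i. v $ i = 0"] by blast
next
  assume ?R
  then obtain c0 c1 c2 c3 c4 c5 where
    nz: "c0 \<noteq> 0 \<or> c1 \<noteq> 0 \<or> c2 \<noteq> 0 \<or> c3 \<noteq> 0 \<or> c4 \<noteq> 0 \<or> c5 \<noteq> 0" and
    c: "\<forall>j. c0 * a $ (0, j) + c1 * a $ (1, j) + c2 * a $ (2, j) + c3 * a $ (3, j)
        + c4 * a $ (4, j)
        + c5 * a $ (5, j) = 0" by blast
  define v :: "'a ^ 6" where "v = (\<chi> i. if i = 0 then c0 else if i = 1 then c1 else if i = 2 then c2
    else if i = 3 then c3 else if i = 4 then c4 else c5)"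
  have v: "v $ 0 = c0" "v $ 1 = c1" "v $ 2 = c2" "v $ 3 = c3" "v $ 4 = c4" "v $ 5 = c5"
    by (simp_all add: v_def)
  have "v \<noteq> 0" using nz v by auto
  with c show ?L unfolding degenerate_def by (intro exI[of _ v]) (simp add: sum_6 v)
qed

lemma all_quadruples:
  fixes P :: "6 \<Rightarrow> 6 \<Rightarrow> 6 \<Rightarrow> 6 \<Rightarrow> bool"
  assumes swap: "\<And>i j k l. P j i k l = P i j k l" "\<And>i j k l. P i k j l = P i j k l" "\<And>i j k l. P i j l k = P i j k l"
  and dup: "\<And>i j k. P i i j k"
  and z: "P 0 1 2 3" "P 0 1 2 4" "P 0 1 2 5" "P 0 1 3 4" "P 0 1 3 5" "P 0 1 4 5" "P 0 2 3 4" "P 0 2 3 5" "P 0 2 4 5" "P 0 3 4 5" "P 1 2 3 4" "P 1 2 3 5" "P 1 2 4 5" "P 1 3 4 5" "P 2 3 4 5"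
  shows "\<forall>i j k l. P i j k l"
proof -
   have dup': "P i j j k" "P i j k k" for i j k using dup swap by metis+
   show ?thesis using z unfolding all_6 by (simp only: swap dup dup' simp_thms)
qed

lemma degenerate_iff_pf:
  fixes a :: "'a::field_char_0 array6"
  assumes "a \<in> skew"
  shows "degenerate a \<longleftrightarrow> pf a = 0"
proof -
  have lower: "a $ (1, 0) = - a $ (0, 1)" "a $ (2, 0) = - a $ (0, 2)" "a $ (3, 0) = - a $ (0, 3)"
    "a $ (4, 0) = - a $ (0, 4)" "a $ (5, 0) = - a $ (0, 5)" "a $ (2, 1) = - a $ (1, 2)"
    "a $ (3, 1) = - a $ (1, 3)" "a $ (4, 1) = - a $ (1, 4)" "a $ (5, 1) = - a $ (1, 5)"
    "a $ (3, 2) = - a $ (2, 3)" "a $ (4, 2) = - a $ (2, 4)" "a $ (5, 2) = - a $ (2, 5)"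
    "a $ (4, 3) = - a $ (3, 4)" "a $ (5, 3) = - a $ (3, 5)" "a $ (5, 4) = - a $ (4, 5)"
    "a $ (i, i) = 0" for i
    using assms by (auto intro: skewD skew_diag)
  show ?thesis
  proof
    assume "degenerate a"
    then obtain v :: "'a ^ 6" where v: "v \<noteq> 0" "\<And>j. (\<Sum>i\<in>UNIV. v $ i * a $ (i, j)) = 0"
      by (auto simp: degenerate_def)
    define S where "S = (\<lambda>j. \<Sum>i\<in>UNIV. v $ i * a $ (i, j))"
    have "v $ 0 * pf a = S 1 * (pf4 a 2 3 4 5) + S 2 * (- pf4 a 1 3 4 5)
        + S 3 * (pf4 a 1 2 4 5) + S 4 * (- pf4 a 1 2 3 5) + S 5 * (pf4 a 1 2 3 4)"
      by (simp add: S_def sum_6 lower pf4_def pf_def algebra_simps)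
    moreover
    have "v $ 1 * pf a = S 0 * (- pf4 a 2 3 4 5) + S 2 * (pf4 a 0 3 4 5)
        + S 3 * (- pf4 a 0 2 4 5) + S 4 * (pf4 a 0 2 3 5) + S 5 * (- pf4 a 0 2 3 4)"
      by (simp add: S_def sum_6 lower pf4_def pf_def algebra_simps)
    moreover
    have "v $ 2 * pf a = S 0 * (pf4 a 1 3 4 5) + S 1 * (- pf4 a 0 3 4 5)
        + S 3 * (pf4 a 0 1 4 5) + S 4 * (- pf4 a 0 1 3 5) + S 5 * (pf4 a 0 1 3 4)"
      by (simp add: S_def sum_6 lower pf4_def pf_def algebra_simps)
    moreover
    have "v $ 3 * pf a = S 0 * (- pf4 a 1 2 4 5) + S 1 * (pf4 a 0 2 4 5)
        + S 2 * (- pf4 a 0 1 4 5) + S 4 * (pf4 a 0 1 2 5) + S 5 * (- pf4 a 0 1 2 4)"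
      by (simp add: S_def sum_6 lower pf4_def pf_def algebra_simps)
    moreover
    have "v $ 4 * pf a = S 0 * (pf4 a 1 2 3 5) + S 1 * (- pf4 a 0 2 3 5)
        + S 2 * (pf4 a 0 1 3 5) + S 3 * (- pf4 a 0 1 2 5) + S 5 * (pf4 a 0 1 2 3)"
      by (simp add: S_def sum_6 lower pf4_def pf_def algebra_simps)
    moreover
    have "v $ 5 * pf a = S 0 * (- pf4 a 1 2 3 4) + S 1 * (pf4 a 0 2 3 4)
        + S 2 * (- pf4 a 0 1 3 4) + S 3 * (pf4 a 0 1 2 4) + S 4 * (- pf4 a 0 1 2 3)"
      by (simp add: S_def sum_6 lower pf4_def pf_def algebra_simps)
    ultimately have "\<forall>k. v $ k * pf a = 0" unfolding all_6 by (simp add: S_def v(2))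
    with v(1) show "pf a = 0" by (auto simp: vec_eq_iff)
  next
    assume pf0: "pf a = 0"
    show "degenerate a"
    proof (rule ccontr)
      assume nd: "\<not> degenerate a"
      have c0: "c0 = 0 \<and> c1 = 0 \<and> c2 = 0 \<and> c3 = 0 \<and> c4 = 0 \<and> c5 = 0"
        if "\<forall>j. c0 * a $ (0, j) + c1 * a $ (1, j) + c2 * a $ (2, j) + c3 * a $ (3, j)
              + c4 * a $ (4, j) + c5 * a $ (5, j) = 0" for c0 c1 c2 c3 c4 c5
        using that nd unfolding degenerate_6 by blast
      have "\<forall>j. (0) * a $ (0, j) + (pf4 a 2 3 4 5) * a $ (1, j)
          + (- pf4 a 1 3 4 5) * a $ (2, j) + (pf4 a 1 2 4 5) * a $ (3, j)
          + (- pf4 a 1 2 3 5) * a $ (4, j)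
          + (pf4 a 1 2 3 4) * a $ (5, j) = (if j = 0 then - pf a else 0)"
        unfolding all_6 by (simp add: lower pf4_def pf_def algebra_simps)
      then have z0: "pf4 a 2 3 4 5 = 0 \<and> - pf4 a 1 3 4 5 = 0 \<and> pf4 a 1 2 4 5 = 0
          \<and> - pf4 a 1 2 3 5 = 0 \<and> pf4 a 1 2 3 4 = 0"
        unfolding pf0 minus_zero if_cancel by (blast dest: c0)
      have "\<forall>j. (- pf4 a 2 3 4 5) * a $ (0, j) + (0) * a $ (1, j)
          + (pf4 a 0 3 4 5) * a $ (2, j) + (- pf4 a 0 2 4 5) * a $ (3, j)
          + (pf4 a 0 2 3 5) * a $ (4, j)
          + (- pf4 a 0 2 3 4) * a $ (5, j) = (if j = 1 then - pf a else 0)"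
        unfolding all_6 by (simp add: lower pf4_def pf_def algebra_simps)
      then have z1: "- pf4 a 2 3 4 5 = 0 \<and> pf4 a 0 3 4 5 = 0
          \<and> - pf4 a 0 2 4 5 = 0 \<and> pf4 a 0 2 3 5 = 0 \<and> - pf4 a 0 2 3 4 = 0"
        unfolding pf0 minus_zero if_cancel by (blast dest: c0)
      have "\<forall>j. (pf4 a 1 3 4 5) * a $ (0, j) + (- pf4 a 0 3 4 5) * a $ (1, j)
          + (0) * a $ (2, j) + (pf4 a 0 1 4 5) * a $ (3, j) + (- pf4 a 0 1 3 5) * a $ (4, j)
          + (pf4 a 0 1 3 4) * a $ (5, j) = (if j = 2 then - pf a else 0)"
        unfolding all_6 by (simp add: lower pf4_def pf_def algebra_simps)
      then have z2: "pf4 a 1 3 4 5 = 0 \<and> - pf4 a 0 3 4 5 = 0 \<and> pf4 a 0 1 4 5 = 0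
          \<and> - pf4 a 0 1 3 5 = 0 \<and> pf4 a 0 1 3 4 = 0"
        unfolding pf0 minus_zero if_cancel by (blast dest: c0)
      have "\<forall>j. (- pf4 a 1 2 4 5) * a $ (0, j) + (pf4 a 0 2 4 5) * a $ (1, j)
          + (- pf4 a 0 1 4 5) * a $ (2, j) + (0) * a $ (3, j) + (pf4 a 0 1 2 5) * a $ (4, j)
          + (- pf4 a 0 1 2 4) * a $ (5, j) = (if j = 3 then - pf a else 0)"
        unfolding all_6 by (simp add: lower pf4_def pf_def algebra_simps)
      then have z3: "- pf4 a 1 2 4 5 = 0 \<and> pf4 a 0 2 4 5 = 0
          \<and> - pf4 a 0 1 4 5 = 0 \<and> pf4 a 0 1 2 5 = 0 \<and> - pf4 a 0 1 2 4 = 0"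
        unfolding pf0 minus_zero if_cancel by (blast dest: c0)
      have "\<forall>j. (pf4 a 1 2 3 5) * a $ (0, j) + (- pf4 a 0 2 3 5) * a $ (1, j)
          + (pf4 a 0 1 3 5) * a $ (2, j) + (- pf4 a 0 1 2 5) * a $ (3, j) + (0) * a $ (4, j)
          + (pf4 a 0 1 2 3) * a $ (5, j) = (if j = 4 then - pf a else 0)"
        unfolding all_6 by (simp add: lower pf4_def pf_def algebra_simps)
      then have z4: "pf4 a 1 2 3 5 = 0 \<and> - pf4 a 0 2 3 5 = 0 \<and> pf4 a 0 1 3 5 = 0
          \<and> - pf4 a 0 1 2 5 = 0 \<and> pf4 a 0 1 2 3 = 0"
        unfolding pf0 minus_zero if_cancel by (blast dest: c0)
      have swap: "pf4 a j i k l = 0 \<longleftrightarrow> pf4 a i j k l = 0" "pf4 a i k j l = 0 \<longleftrightarrow> pf4 a i j k l = 0"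
        "pf4 a i j l k = 0 \<longleftrightarrow> pf4 a i j k l = 0" for i j k l
      proof -
        have "pf4 a j i k l = - pf4 a i j k l" "pf4 a i k j l = - pf4 a i j k l"
          "pf4 a i j l k = - pf4 a i j k l"
          by (simp_all add: pf4_def skewD[OF assms, of j i] skewD[OF assms, of k j]
              skewD[OF assms, of l k])
        then show "pf4 a j i k l = 0 \<longleftrightarrow> pf4 a i j k l = 0" "pf4 a i k j l = 0 \<longleftrightarrow> pf4 a i j k l = 0"
          "pf4 a i j l k = 0 \<longleftrightarrow> pf4 a i j k l = 0" by simp_all
      qed
      have "pf4 a i i k l = 0" for i k l
        by (simp add: pf4_def skew_diag[OF assms])
      then have m0: "\<forall>i j k l. pf4 a i j k l = 0"
        using z0 z1 z2 z3 z4 swap by (intro all_quadruples) auto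
      have "degenerate a"
      proof (cases "a = 0")
        case True
        have "(\<chi> i. 1) \<noteq> (0 :: 'a ^ 6)" by (auto simp: vec_eq_iff)
        then show ?thesis unfolding degenerate_def using True
          by (intro exI[of _ "\<chi> i. 1"]) simp
      next
        case False
        then obtain i j where ij: "a $ (i, j) \<noteq> 0" by (auto simp: vec_eq_iff)
        have "card {i, j} \<noteq> card (UNIV :: 6 set)" by (simp add: card_insert_if)
        then have "{i, j} \<noteq> UNIV" by (rule contrapos_nn) (rule arg_cong)
        then obtain k where k: "k \<noteq> i" "k \<noteq> j" by blast
        define v :: "'a ^ 6" where
          "v = (\<chi> x. (if x = i then a $ (j, k) else 0) - (if x = j then a $ (i, k) else 0)
                     + (if x = k then a $ (i, j) else 0))"
        have "v $ k \<noteq> 0" using k ij by (simp add: v_def)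
        then have "v \<noteq> 0" by auto
        moreover have "(\<Sum>x\<in>UNIV. v $ x * a $ (x, l)) = 0" for l
        proof -
          have "v $ x * a $ (x, l) =
             (if x = i then a $ (j, k) * a $ (i, l) else 0)
                 - (if x = j then a $ (i, k) * a $ (j, l) else 0)
               + (if x = k then a $ (i, j) * a $ (k, l) else 0)" for x
            by (simp add: v_def left_diff_distrib distrib_right)
          then have "(\<Sum>x\<in>UNIV. v $ x * a $ (x, l)) = (\<Sum>x\<in>UNIV.
             (if x = i then a $ (j, k) * a $ (i, l) else 0)
                 - (if x = j then a $ (i, k) * a $ (j, l) else 0)
               + (if x = k then a $ (i, j) * a $ (k, l) else 0))"
            by simp
          also have "\<dots> = pf4 a i j k l"
            by (simp add: sum.distrib sum_subtractf pf4_def mult.commute)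
          finally show ?thesis using m0 by simp
        qed
        ultimately show ?thesis unfolding degenerate_def by blast
      qed
      with nd show False by contradiction
    qed
  qed
qed

section \<open>Projective schemes over the complex numbers\<close>

text \<open>
  A closed subscheme of a projective space P(L), for a linear subspace L of \<open>\<complex>\<^sup>n\<close>, is given by
  L together with homogeneous equations. Polynomials on L are handled as polynomial functions
  restricted to L, which loses nothing over an infinite field.
\<close>

inductive_set polyfun :: "(complex ^ 'n \<Rightarrow> complex) set" where
  const: "(\<lambda>x. c) \<in> polyfun"
| coord: "(\<lambda>x. x $ i) \<in> polyfun"
| add: "F \<in> polyfun \<Longrightarrow> G \<in> polyfun \<Longrightarrow> (\<lambda>x. F x
    + G x) \<in> polyfun"
| mult: "F \<in> polyfun \<Longrightarrow> G \<in> polyfun \<Longrightarrow> (\<lambda>x. F x * G x) \<in> polyfun"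

type_synonym 'n pscheme = "(complex ^ 'n) set \<times> (complex ^ 'n \<Rightarrow> complex) set"

definition ideal_on :: "(complex ^ 'n) set \<Rightarrow> (complex ^ 'n \<Rightarrow> complex) set
    \<Rightarrow> (complex ^ 'n \<Rightarrow> complex) set" where
  "ideal_on L E = {F. \<exists>A c. finite A \<and> A \<subseteq> E
      \<and> c ` A \<subseteq> polyfun \<and>
                      (\<forall>x\<in>L. F x = (\<Sum>g\<in>A. c g x * g x))}"

text \<open>Polynomials on L lying in the ideal generated by E in the local ring of L at p.\<close>

definition local_ideal :: "(complex ^ 'n) set \<Rightarrow> (complex ^ 'n \<Rightarrow> complex) set
    \<Rightarrow> complex ^ 'n \<Rightarrow> (complex ^ 'n \<Rightarrow> complex) set" where
  "local_ideal L E p = {F \<in> polyfun. \<exists>h\<in>polyfun. h p \<noteq> 0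
      \<and> (\<lambda>x. h x * F x) \<in> ideal_on L E}"

definition differential :: "(complex ^ 'n \<Rightarrow> complex) \<Rightarrow> complex ^ 'n \<Rightarrow> complex ^ 'n \<Rightarrow> complex" where
  "differential F p v = deriv (\<lambda>t. F (p + t *s v)) 0"

definition independent_differentials :: "(complex ^ 'n) set \<Rightarrow> (complex ^ 'n \<Rightarrow> complex) set
    \<Rightarrow> complex ^ 'n \<Rightarrow> bool" where
  "independent_differentials L G p \<longleftrightarrow>
     (\<forall>c. (\<forall>v\<in>L. (\<Sum>g\<in>G. c g * differential g p v) = 0) \<longrightarrow> (\<forall>g\<in>G. c g = 0))"

definition cone :: "'n pscheme \<Rightarrow> (complex ^ 'n) set" where
  "cone X = {x \<in> fst X. \<forall>F\<in>snd X. F x = 0}"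

text \<open>
  Smooth of dimension d: near every point the ideal is generated by as many equations as the
  codimension, with linearly independent differentials at the point. This is expressed on the
  punctured affine cone, which is smooth of dimension d + 1 exactly when the projective scheme is
  smooth of dimension d; the codimension is \<open>dim L - (d
      + 1)\<close> in both cases. A hypersurface
  F = 0 may take G = {F}, and the condition becomes that dF has no zero on the punctured cone.
\<close>

definition smooth_of_dim :: "'n::finite pscheme \<Rightarrow> nat \<Rightarrow> bool" where
  "smooth_of_dim X d \<longleftrightarrow> (case X of (L, E) \<Rightarrow>
     \<forall>p\<in>cone X. p \<noteq> 0 \<longrightarrow>
       (\<exists>G. finite G \<and> card G + (d + 1) = vec.dim L \<and>
            G \<subseteq> local_ideal L E p \<and> E \<subseteq> local_ideal L G p \<and>
            independent_differentials L G p))"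

text \<open>Contains a projective linear subspace of dimension k.\<close>

definition contains_linear_space :: "'n::finite pscheme \<Rightarrow> nat \<Rightarrow> bool" where
  "contains_linear_space X k \<longleftrightarrow> (\<exists>M. vec.subspace M
      \<and> vec.dim M = k + 1 \<and> M \<subseteq> cone X)"

abbreviation "contains_line X \<equiv> contains_linear_space X 1"
abbreviation "contains_plane X \<equiv> contains_linear_space X 2"

section \<open>Pfaffian cubics and dual K3 surfaces\<close>

definition complexify :: "(rat ^ 'n) set \<Rightarrow> (complex ^ 'n) set" where
  "complexify U = vec.span ((\<lambda>x. \<chi> i. of_rat (x $ i)) ` U)"

definition pfaffian_cubic :: "rat array6 set \<Rightarrow> (6 \<times> 6) pscheme" where
  "pfaffian_cubic U = (complexify U, {pf})"

definition dual_K3 :: "rat array6 set \<Rightarrow> (6 \<times> 6) pscheme" where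
  "dual_K3 W = (complexify (annihilator W), pluecker_quadrics)"

definition pfaffian_flag :: "rat array6 set \<Rightarrow> rat array6 set \<Rightarrow> bool" where
  "pfaffian_flag Z W \<longleftrightarrow> vec.subspace Z \<and> vec.subspace W
      \<and> Z \<subseteq> W \<and> W \<subseteq> skew \<and>
     vec.dim Z = 5 \<and> vec.dim W = 6"

text \<open>
  The fourfold of W is the cyclic triple cover of P(Z) along the threefold of Z: W is the direct sum
  of Z and a line spanned by w and, t being the coordinate along w, the fourfold has an
  equation \<open>f(z)
      + t\<^sup>3\<close>, where f is an equation of the threefold. Equations of a hypersurface are
  determined up to nonzero scalars, here a and b.
\<close>

definition cyclic_triple_cover :: "rat array6 set \<Rightarrow> rat array6 set \<Rightarrow> bool" where
  "cyclic_triple_cover Z W \<longleftrightarrow>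
     (\<exists>w a b. w \<notin> Z \<and> W = vec.span (insert w Z) \<and> a \<noteq> 0
         \<and> b \<noteq> 0 \<and>
        (\<forall>z\<in>Z. \<forall>t. b * pf (z + t *s w) = a * pf z + t ^ 3))"

end

theory Submission
  imports Defs "HOL-Computational_Algebra.Polynomial"
begin

text \<open>
  All assertions are reduced to two properties of one cubic form f in five variables, and these are
  checked after reduction modulo 3.
  
  The flag is given by an explicit family of skew matrices \<open>pfaffian_form\<close>, linear in \<open>x\<^sub>0, ..., x\<^sub>5\<close>,
  with Pfaffian \<open>- (f + t^3)\<close> where \<open>t = x\<^sub>5\<close>. The fourfold Y is therefore the cyclic triple cover of the
  threefold C with equation f = 0, and Y is smooth if C is, because the derivative of \<open>t^3\<close> vanishes
  only at t = 0.
  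
  The K3 surface inherits its properties from Y. If it is not smooth at \<open>u \<and> v\<close>, then some nonzero form
  \<open>\<omega>\<close> of W has u and v in its kernel; the derivative of the Pfaffian at \<open>\<omega>\<close> in the direction \<open>\<eta>\<close> is a
  multiple of \<open>\<eta>(u, v)\<close>, which is zero for all \<open>\<eta>\<close> in W, so that \<open>\<omega>\<close> is a singular point of Y
  (\<open>no_kernel_plane\<close>). If it contains a line, the bivectors on that line share a vector u, and the forms
  of W with u in the kernel form a linear space of dimension at least three inside Y
  (\<open>no_line_dual_K3\<close>).
  
  It remains to see that f is smooth and that no plane lies on \<open>f + t^3 = 0\<close>. Both are preserved when one
  passes back from a residue field: a valuation ring of the complex numbers in which 3 is not
  invertible is obtained as a maximal subring without 1/3, and singular points and linear spaces
  specialise to its residue field (\<open>cubic_smooth\<close>, \<open>fourfold_no_plane\<close>). In characteristic 3 the cube of a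
  linear form has zero derivative. Hence on a plane in \<open>f + t^3 = 0\<close> the derivative of f vanishes along the
  plane, a system of bilinear conditions that elementary linear algebra refutes for the chosen f
  (\<open>no_plane_char3\<close>).
\<close>

section \<open>Valuation rings from maximal subrings\<close>

definition subring :: "'a::field set \<Rightarrow> bool" where
  "subring A \<longleftrightarrow> 1 \<in> A \<and> (\<forall>x\<in>A. \<forall>y\<in>A. x - y \<in> A \<and> x * y \<in> A)"

lemma subring_closed:
  assumes "subring A"
  shows "1 \<in> A" "0 \<in> A" "x \<in> A \<Longrightarrow> - x \<in> A" "x \<in> A \<Longrightarrow> y \<in> A \<Longrightarrow> x - y \<in> A"
    "x \<in> A \<Longrightarrow> y \<in> A \<Longrightarrow> x + y \<in> A" "x \<in> A \<Longrightarrow> y \<in> A \<Longrightarrow> x * y \<in> A"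
proof -
  have d: "x - y \<in> A" if "x \<in> A" "y \<in> A" for x y
    using assms that by (simp add: subring_def)
  show one: "1 \<in> A" and "x \<in> A \<Longrightarrow> y \<in> A \<Longrightarrow> x * y \<in> A"
    using assms by (auto simp: subring_def)
  show zero: "0 \<in> A"
    using d[OF one one] by simp
  have n: "- x \<in> A" if "x \<in> A" for x
    using d[OF zero that] by simp
  show "x \<in> A \<Longrightarrow> - x \<in> A" "x \<in> A \<Longrightarrow> y \<in> A \<Longrightarrow> x - y \<in> A"
    by (fact n, fact d)
  show "x + y \<in> A" if "x \<in> A" "y \<in> A"
    using d[OF that(1) n[OF that(2)]] by simp
qed

lemma subring_sum:
  assumes "subring A" and "\<And>i. i \<in> I \<Longrightarrow> g i \<in> A"
  shows "sum g I \<in> A"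
  using assms(2) by (induction I rule: infinite_finite_induct) (auto simp: subring_closed[OF assms(1)])

definition polys_over :: "'a::field set \<Rightarrow> 'a poly set" where
  "polys_over A = {p. \<forall>i. coeff p i \<in> A}"

lemma polys_over_closed:
  assumes "subring A"
  shows "1 \<in> polys_over A" "p \<in> polys_over A \<Longrightarrow> q \<in> polys_over A \<Longrightarrow> p - q \<in> polys_over A"
    "p \<in> polys_over A \<Longrightarrow> q \<in> polys_over A \<Longrightarrow> p + q \<in> polys_over A"
    "p \<in> polys_over A \<Longrightarrow> q \<in> polys_over A \<Longrightarrow> p * q \<in> polys_over A"
    "c \<in> A \<Longrightarrow> monom c n \<in> polys_over A"
  using assms
  by (auto simp: polys_over_def coeff_mult coeff_1 subring_closed intro!: subring_sum)

lemma subring_adjoin: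
  assumes "subring A"
  shows "subring ((\<lambda>p. poly p x) ` polys_over A)"
  unfolding subring_def
proof (intro conjI ballI)
  show "1 \<in> (\<lambda>p. poly p x) ` polys_over A"
    by (rule image_eqI[of _ _ 1]) (auto simp: polys_over_closed[OF assms])
  fix a b assume "a \<in> (\<lambda>p. poly p x) ` polys_over A" "b \<in> (\<lambda>p. poly p x) ` polys_over A"
  then obtain p q where pq: "p \<in> polys_over A" "q \<in> polys_over A" "a = poly p x" "b = poly q x"
    by blast
  show "a - b \<in> (\<lambda>p. poly p x) ` polys_over A"
    by (rule image_eqI[of _ _ "p - q"]) (auto simp: polys_over_closed[OF assms] pq)
  show "a * b \<in> (\<lambda>p. poly p x) ` polys_over A"
    by (rule image_eqI[of _ _ "p * q"]) (auto simp: polys_over_closed[OF assms] pq)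
qed

text \<open>
  The ring A is as large as possible without containing \<open>1/\<pi>\<close>. Such a ring is a valuation ring of
  its field, and \<open>\<pi>\<close> lies in its maximal ideal: this is how a residue field is produced in which \<open>\<pi>\<close>
  becomes zero.
\<close>

locale maximal_avoiding =
  fixes A :: "'a::field set" and \<pi> :: 'a
  assumes ring: "subring A" and pi: "\<pi> \<in> A" and avoid: "inverse \<pi> \<notin> A"
    and maximal: "\<And>B. subring B \<Longrightarrow> A \<subseteq> B \<Longrightarrow> inverse \<pi> \<notin> B \<Longrightarrow> B = A"
begin

lemma pi_nonzero: "\<pi> \<noteq> 0"
  using avoid subring_closed(2)[OF ring] by auto

lemma one_plus_nonzero: "1 + \<pi> * c \<noteq> 0" if "c \<in> A"
proof
  assume "1 + \<pi> * c = 0"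
  then have "inverse \<pi> = - c"
    using pi_nonzero by (simp add: field_simps eq_neg_iff_add_eq_0)
  then show False
    using avoid that subring_closed[OF ring] by auto
qed

text \<open>
  Localising at the elements \<open>1 + \<pi> b\<close> does not invert \<open>\<pi>\<close>, since \<open>1/\<pi> = a / (1 + \<pi> b)\<close> would give
  \<open>1/\<pi> = a - b\<close>. By maximality these elements are already units.
\<close>

lemma inverse_one_plus: "inverse (1 + \<pi> * c) \<in> A" if "c \<in> A"
proof -
  define B where "B = {a / (1 + \<pi> * b) | a b. a \<in> A \<and> b \<in> A}"
  note cl = subring_closed[OF ring] pi
  have "subring B"
    unfolding subring_def
  proof (intro conjI ballI)
    have "1 = 1 / (1 + \<pi> * 0)" by simp
    then show "1 \<in> B" unfolding B_def using cl by blast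
    fix x y assume "x \<in> B" "y \<in> B"
    then obtain a b c d where x: "x = a / (1 + \<pi> * b)" "a \<in> A" "b \<in> A"
      and y: "y = c / (1 + \<pi> * d)" "c \<in> A" "d \<in> A"
      unfolding B_def by blast
    have den: "(1 + \<pi> * b) * (1 + \<pi> * d) = 1 + \<pi> * (b + d + \<pi> * b * d)"
      by (simp add: algebra_simps)
    have "x - y = (a * (1 + \<pi> * d) - c * (1 + \<pi> * b)) / ((1 + \<pi> * b) * (1 + \<pi> * d))"
      using one_plus_nonzero x y by (simp add: diff_frac_eq)
    moreover have "a * (1 + \<pi> * d) - c * (1 + \<pi> * b) \<in> A" "b + d + \<pi> * b * d \<in> A"
      using x y cl by simp_all
    ultimately show "x - y \<in> B"
      unfolding den B_def by blast
    have "x * y = (a * c) / (1 + \<pi> * (b + d + \<pi> * b * d))"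
      using x y by (simp add: den[symmetric])
    moreover have "a * c \<in> A" "b + d + \<pi> * b * d \<in> A"
      using x y cl by simp_all
    ultimately show "x * y \<in> B"
      unfolding B_def by blast
  qed
  moreover have "A \<subseteq> B"
  proof
    fix a assume "a \<in> A"
    moreover have "a = a / (1 + \<pi> * 0)" by simp
    ultimately show "a \<in> B" unfolding B_def using cl by blast
  qed
  moreover have "inverse \<pi> \<notin> B"
  proof
    assume "inverse \<pi> \<in> B"
    then obtain a b where ab: "inverse \<pi> = a / (1 + \<pi> * b)" "a \<in> A" "b \<in> A"
      unfolding B_def by blast
    then have "inverse \<pi> = a - b"
      using pi_nonzero one_plus_nonzero[of b] by (simp add: field_simps)
    then show False
      using avoid ab cl by simp
  qed
  ultimately have "B = A"
    by (rule maximal)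
  moreover have "inverse (1 + \<pi> * c) = 1 / (1 + \<pi> * c)"
    by (simp add: field_simps)
  then have "inverse (1 + \<pi> * c) \<in> B"
    unfolding B_def using that cl by blast
  ultimately show ?thesis by simp
qed

lemma adjoin_relation:
  assumes "x \<notin> A"
  shows "\<exists>p\<in>polys_over A. \<pi> * poly p x = 1"
proof -
  let ?B = "(\<lambda>p. poly p x) ` polys_over A"
  have "A \<subseteq> ?B"
  proof
    fix a assume "a \<in> A"
    then show "a \<in> ?B"
      by (intro image_eqI[of _ _ "monom a 0"]) (auto simp: polys_over_closed[OF ring] poly_monom)
  qed
  moreover have "x \<in> ?B"
    by (rule image_eqI[of _ _ "monom 1 1"])
      (auto simp: poly_monom polys_over_closed[OF ring] subring_closed[OF ring])
  ultimately have "inverse \<pi> \<in> ?B"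
    using maximal[OF subring_adjoin[OF ring, of x]] assms by auto
  then obtain p where "p \<in> polys_over A" "poly p x = inverse \<pi>" by auto
  then show ?thesis using pi_nonzero by (intro bexI[of _ p]) auto
qed

text \<open>
  The relation satisfied by \<open>1/x\<close> has the form \<open>(1 - \<pi> b) x^m = \<pi> r(x)\<close> with r of degree below m. Since
  \<open>1 - \<pi> b\<close> is a unit it expresses \<open>x^m\<close> through lower powers, and substituting this in the leading
  term of the relation for x lowers its degree. Used on relations of minimal degree, this is a
  contradiction.
\<close>

lemma valuation_step:
  assumes x: "x \<noteq> 0"
    and p: "p \<in> polys_over A" "\<pi> * poly p x = 1"
    and q: "q \<in> polys_over A" "\<pi> * poly q (inverse x) = 1"
    and le: "degree q \<le> degree p"
  shows "\<exists>p'\<in>polys_over A. \<pi> * poly p' x = 1 \<and> degree p' < degree p"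
proof -
  note cl = subring_closed[OF ring] pi and pcl = polys_over_closed[OF ring]
  define m where "m = degree q"
  define n where "n = degree p"
  have nz: "0 < degree r" if "r \<in> polys_over A" "\<pi> * poly r y = 1" for r y
  proof (rule ccontr)
    assume "\<not> 0 < degree r"
    then obtain c where c: "r = [:c:]" by (auto dest: degree_eq_zeroE)
    then have "coeff r 0 = c" by simp
    then have "c \<in> A" using that(1) by (auto simp: polys_over_def)
    moreover have "inverse \<pi> = c" using c that(2) pi_nonzero by (simp add: field_simps)
    ultimately show False using avoid by simp
  qed
  have m0: "0 < m" and n0: "0 < n"
    using nz p q by (auto simp: m_def n_def)
  \<comment> \<open>the reversed polynomial of q without its leading coefficient \<open>coeff q 0\<close>\<close>
  define r where "r = (\<Sum>i=1..m. monom (coeff q i) (m - i))"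
  have rA: "r \<in> polys_over A"
  proof -
    have "coeff r j \<in> A" for j
      unfolding r_def coeff_sum using q cl by (intro subring_sum[OF ring]) (auto simp: polys_over_def)
    then show ?thesis by (simp add: polys_over_def)
  qed
  have rdeg: "degree r < m"
  proof -
    have "degree r \<le> m - 1"
      unfolding r_def
      by (intro degree_sum_le) (auto intro: order_trans[OF degree_monom_le])
    then show ?thesis using m0 by linarith
  qed
  have qx: "x ^ m * poly q (inverse x) = poly r x + coeff q 0 * x ^ m"
  proof -
    have "x ^ m * poly q (inverse x) = (\<Sum>i\<le>m. coeff q i * x ^ (m - i))"
      using x by (simp add: poly_altdef m_def sum_distrib_left power_diff field_simps power_inverse)
    also have "\<dots> = (\<Sum>i\<in>insert 0 {1..m}. coeff q i * x ^ (m - i))"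
      by (rule sum.cong) auto
    also have "\<dots> = coeff q 0 * x ^ m + (\<Sum>i=1..m. coeff q i * x ^ (m - i))"
      by (subst sum.insert) auto
    finally show ?thesis by (simp add: r_def poly_sum poly_monom)
  qed
  have q0: "coeff q 0 \<in> A" using q by (auto simp: polys_over_def)
  define u where "u = inverse (1 + \<pi> * (- coeff q 0))"
  have uA: "u \<in> A" unfolding u_def using inverse_one_plus cl q0 by blast
  have unz: "1 + \<pi> * (- coeff q 0) \<noteq> 0" using one_plus_nonzero cl q0 by blast
  have "x ^ m * (1 + \<pi> * (- coeff q 0)) = \<pi> * poly r x"
  proof -
    have "x ^ m = x ^ m * (\<pi> * poly q (inverse x))" using q by simp
    also have "\<dots> = \<pi> * (x ^ m * poly q (inverse x))" by simp
    also have "\<dots> = \<pi> * poly r x + \<pi> * coeff q 0 * x ^ m" by (simp add: qx algebra_simps)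
    finally show ?thesis by (simp add: algebra_simps)
  qed
  then have xm: "x ^ m = u * \<pi> * poly r x"
    using unz by (simp add: u_def field_simps)
  define p' where "p' = p - monom (coeff p n) n + monom (u * \<pi> * coeff p n) (n - m) * r"
  have pn: "coeff p n \<in> A" using p by (auto simp: polys_over_def)
  have "p' \<in> polys_over A"
    unfolding p'_def using p rA pn uA by (intro pcl cl) auto
  moreover have "poly p' x = poly p x"
  proof -
    have "x ^ n = x ^ (n - m) * x ^ m" using le by (simp add: m_def n_def flip: power_add)
    then show ?thesis by (simp add: p'_def poly_monom xm algebra_simps)
  qed
  moreover have "degree p' < n"
  proof -
    have "degree (p - monom (coeff p n) n) < n"
    proof (rule degree_lessI)
      show "p - monom (coeff p n) n \<noteq> 0 \<or> 0 < n" using n0 by simp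
      show "\<forall>k\<ge>n. coeff (p - monom (coeff p n) n) k = 0"
        by (auto simp: n_def coeff_eq_0)
    qed
    moreover have "degree (monom (u * \<pi> * coeff p n) (n - m) * r) < n"
    proof -
      have "degree (monom (u * \<pi> * coeff p n) (n - m) * r) \<le> (n - m) + degree r"
        by (rule order_trans[OF degree_mult_le]) (simp add: degree_monom_le)
      also have "\<dots> < n" using rdeg le m0 by (simp add: m_def n_def)
      finally show ?thesis .
    qed
    ultimately show ?thesis unfolding p'_def by (rule degree_add_less)
  qed
  ultimately show ?thesis using p(2) by (intro bexI[of _ p']) (simp_all add: n_def)
qed

theorem valuation: "x \<in> A \<or> inverse x \<in> A"
proof (rule ccontr)
  assume "\<not> ?thesis"
  then have x: "x \<notin> A" "inverse x \<notin> A" by auto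
  then have x0: "x \<noteq> 0" using subring_closed[OF ring] by auto
  define R where "R y = {p \<in> polys_over A. \<pi> * poly p y = 1}" for y
  have ne: "\<exists>p. p \<in> R x" "\<exists>p. p \<in> R (inverse x)"
    using adjoin_relation x by (auto simp: R_def)
  obtain p where p: "p \<in> R x" "\<And>p'. p' \<in> R x \<Longrightarrow> degree p \<le> degree p'"
    using ex_has_least_nat[of "\<lambda>p. p \<in> R x" _ degree] ne by metis
  obtain q where q: "q \<in> R (inverse x)" "\<And>q'. q' \<in> R (inverse x) \<Longrightarrow> degree q \<le> degree q'"
    using ex_has_least_nat[of "\<lambda>p. p \<in> R (inverse x)" _ degree] ne by metis
  show False
  proof (cases "degree q \<le> degree p")
    case True
    then obtain p' where "p' \<in> R x" "degree p' < degree p"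
      using valuation_step[OF x0, of p q] p(1) q(1) unfolding R_def by blast
    then show False using p(2) by fastforce
  next
    case False
    then obtain q' where "q' \<in> R (inverse x)" "degree q' < degree q"
      using valuation_step[of "inverse x" q p] x0 p(1) q(1) unfolding R_def by auto
    then show False using q(2) by fastforce
  qed
qed

end

lemma ex_maximal_avoiding:
  assumes "subring A" "\<pi> \<in> A" "inverse \<pi> \<notin> A"
  shows "\<exists>B. A \<subseteq> B \<and> maximal_avoiding B \<pi>"
proof -
  define F where "F = {B. subring B \<and> A \<subseteq> B \<and> inverse \<pi> \<notin> B}"
  have "\<exists>M\<in>F. \<forall>X\<in>F. M \<subseteq> X \<longrightarrow> X = M"
  proof (rule subset_Zorn_nonempty)
    show "F \<noteq> {}" using assms by (auto simp: F_def)
    fix C assume C: "C \<noteq> {}" "subset.chain F C"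
    have CF: "C \<subseteq> F" and tot: "\<And>X Y. X \<in> C \<Longrightarrow> Y \<in> C \<Longrightarrow> X \<subseteq> Y \<or> Y \<subseteq> X"
      using C(2) by (auto simp: subset.chain_def)
    have "subring (\<Union>C)"
      unfolding subring_def
    proof (intro conjI ballI)
      show "1 \<in> \<Union>C" using C(1) CF by (auto simp: F_def subring_def)
      fix x y assume "x \<in> \<Union>C" "y \<in> \<Union>C"
      then obtain X where X: "X \<in> C" "x \<in> X" "y \<in> X" using tot by blast
      then have "subring X" using CF by (auto simp: F_def)
      then show "x - y \<in> \<Union>C" "x * y \<in> \<Union>C" using X by (auto simp: subring_def)
    qed
    then show "\<Union>C \<in> F" using C(1) CF by (auto simp: F_def)
  qed
  then obtain M where M: "M \<in> F" "\<And>X. X \<in> F \<Longrightarrow> M \<subseteq> X \<Longrightarrow> X = M" by blast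
  then have "maximal_avoiding M \<pi>"
    using assms by unfold_locales (auto simp: F_def)
  then show ?thesis using M by (auto simp: F_def)
qed

section \<open>A residue field of characteristic 3\<close>

text \<open>
  One valuation ring of the complex numbers is fixed once and for all, so that its residue field can
  be a type and the linear algebra over that field can use the type class of fields.
\<close>

definition vring :: "complex set" where
  "vring = (SOME B. maximal_avoiding B 3)"

lemma maximal_avoiding_vring: "maximal_avoiding vring 3"
proof -
  have "subring (\<int> :: complex set)"
    by (auto simp: subring_def)
  moreover have "inverse 3 \<notin> (\<int> :: complex set)"
  proof
    assume "inverse 3 \<in> (\<int> :: complex set)"
    then obtain k :: int where "inverse 3 = (of_int k :: complex)"
      by (auto elim: Ints_cases)
    then have "(of_int (3 * k) :: complex) = of_int 1"
      by (simp add: field_simps)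
    then have "3 * k = 1" by (simp only: of_int_eq_iff)
    then show False by presburger
  qed
  ultimately have "\<exists>B::complex set. maximal_avoiding B 3"
    using ex_maximal_avoiding[of "\<int> :: complex set" 3] Ints_numeral by blast
  then show ?thesis unfolding vring_def by (rule someI_ex)
qed

interpretation vring: maximal_avoiding vring 3
  by (rule maximal_avoiding_vring)

lemmas vring_closed [simp, intro] = subring_closed[OF vring.ring]

definition nonunits :: "complex set" where
  "nonunits = {x \<in> vring. x = 0 \<or> inverse x \<notin> vring}"

lemma zero_nonunit: "0 \<in> nonunits"
  by (simp add: nonunits_def)

lemma one_not_nonunit: "1 \<notin> nonunits"
  by (simp add: nonunits_def)

lemma three_nonunit: "3 \<in> nonunits"
  using vring.pi vring.avoid by (simp add: nonunits_def)

lemma nonunits_mult: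
  assumes "x \<in> nonunits" "y \<in> vring"
  shows "x * y \<in> nonunits"
proof (cases "x * y = 0")
  case False
  have "inverse (x * y) \<notin> vring"
  proof
    assume "inverse (x * y) \<in> vring"
    then have "y * inverse (x * y) \<in> vring" using assms by auto
    moreover have "y * inverse (x * y) = inverse x" using False by (simp add: field_simps)
    ultimately have "inverse x \<in> vring" by (simp only:)
    then show False using assms False by (auto simp: nonunits_def)
  qed
  then show ?thesis using assms by (auto simp: nonunits_def)
qed (auto simp: zero_nonunit)

lemma nonunits_add_aux:
  assumes "x \<in> nonunits" "y \<in> nonunits" "y \<noteq> 0" "x / y \<in> vring"
  shows "x + y \<in> nonunits"
proof -
  have "x + y = y * (1 + x / y)" using assms by (simp add: field_simps)
  then show ?thesis using assms by (auto intro: nonunits_mult)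
qed

lemma nonunits_add:
  assumes "x \<in> nonunits" "y \<in> nonunits"
  shows "x + y \<in> nonunits"
proof (cases "x = 0 \<or> y = 0")
  case False
  have "x / y \<in> vring \<or> y / x \<in> vring"
    using vring.valuation[of "x / y"] by (simp add: inverse_eq_divide)
  then show ?thesis
    using nonunits_add_aux[of x y] nonunits_add_aux[of y x] assms False by (auto simp: add.commute)
qed (use assms in auto)

lemma nonunits_uminus: "x \<in> nonunits \<Longrightarrow> - x \<in> nonunits"
  using nonunits_mult[of x "-1"] by auto

lemma nonunits_diff: "x \<in> nonunits \<Longrightarrow> y \<in> nonunits \<Longrightarrow> x - y \<in> nonunits"
  using nonunits_add[OF _ nonunits_uminus, of x y] by simp

lemma inverse_unit: "x \<in> vring \<Longrightarrow> x \<notin> nonunits \<Longrightarrow> inverse x \<in> vring"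
  by (auto simp: nonunits_def)

lemma unit_nonzero: "x \<notin> nonunits \<Longrightarrow> x \<noteq> 0"
  using zero_nonunit by auto

quotient_type residue = complex / partial: "\<lambda>x y. x \<in> vring \<and> y \<in> vring \<and> x - y \<in> nonunits"
  morphisms rep_residue residue_class
proof (rule part_equivpI)
  show "\<exists>x. x \<in> vring \<and> x \<in> vring \<and> x - x \<in> nonunits"
    using zero_nonunit by auto
  show "symp (\<lambda>x y. x \<in> vring \<and> y \<in> vring \<and> x - y \<in> nonunits)"
    using nonunits_uminus by (force simp: symp_def)
  show "transp (\<lambda>x y. x \<in> vring \<and> y \<in> vring \<and> x - y \<in> nonunits)"
    using nonunits_add by (force simp: transp_def)
qed

instantiation residue :: comm_ring_1
begin

lift_definition zero_residue :: residue is 0 using zero_nonunit by simp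
lift_definition one_residue :: residue is 1 using zero_nonunit by simp
lift_definition plus_residue :: "residue \<Rightarrow> residue \<Rightarrow> residue" is "(+)"
  using nonunits_add by (fastforce simp: add_diff_add)
lift_definition minus_residue :: "residue \<Rightarrow> residue \<Rightarrow> residue" is "(-)"
proof (elim conjE, intro conjI)
  fix a b c d :: complex
  assume *: "a \<in> vring" "b \<in> vring" "a - b \<in> nonunits" "c \<in> vring" "d \<in> vring" "c - d \<in> nonunits"
  show "a - c \<in> vring" "b - d \<in> vring" using * by auto
  have "a - c - (b - d) = (a - b) - (c - d)" by simp
  then show "a - c - (b - d) \<in> nonunits" using * nonunits_diff by presburger
qed
lift_definition uminus_residue :: "residue \<Rightarrow> residue" is uminus
  using nonunits_uminus by fastforce
lift_definition times_residue :: "residue \<Rightarrow> residue \<Rightarrow> residue" is "(*)"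
proof (elim conjE, intro conjI)
  fix a b c d :: complex
  assume *: "a \<in> vring" "b \<in> vring" "a - b \<in> nonunits" "c \<in> vring" "d \<in> vring" "c - d \<in> nonunits"
  show "a * c \<in> vring" "b * d \<in> vring" using * by auto
  have "a * c - b * d = (a - b) * c + (c - d) * b" by (simp add: algebra_simps)
  then show "a * c - b * d \<in> nonunits" using * nonunits_mult nonunits_add by presburger
qed

instance
proof
  show "(0 :: residue) \<noteq> 1"
    by transfer (use one_not_nonunit nonunits_uminus[of "-1"] in auto)
qed (transfer, auto simp: zero_nonunit algebra_simps)+

end

instantiation residue :: field
begin

lift_definition inverse_residue :: "residue \<Rightarrow> residue"
  is "\<lambda>x. if x \<in> nonunits then 0 else inverse x"
proof (elim conjE)
  fix a b assume *: "a \<in> vring" "b \<in> vring" "a - b \<in> nonunits"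
  have iff: "a \<in> nonunits \<longleftrightarrow> b \<in> nonunits"
    using nonunits_add[of "a - b" b] nonunits_diff[of a "a - b"] * by auto
  show "(if a \<in> nonunits then 0 else inverse a) \<in> vring \<and>
    (if b \<in> nonunits then 0 else inverse b) \<in> vring \<and>
    (if a \<in> nonunits then 0 else inverse a) - (if b \<in> nonunits then 0 else inverse b) \<in> nonunits"
  proof (cases "a \<in> nonunits")
    case True
    then show ?thesis using iff zero_nonunit by simp
  next
    case False
    then have nz: "a \<noteq> 0" "b \<noteq> 0" using iff unit_nonzero by auto
    have inv: "inverse a \<in> vring" "inverse b \<in> vring" using False iff * inverse_unit by auto
    have "inverse a - inverse b = (a - b) * (- (inverse a * inverse b))"
      using nz by (simp add: field_simps)
    then have "inverse a - inverse b \<in> nonunits"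
      using * inv nonunits_mult by (metis vring_closed(3,6))
    then show ?thesis using False iff inv by simp
  qed
qed

definition divide_residue :: "residue \<Rightarrow> residue \<Rightarrow> residue" where
  "divide_residue x y = x * inverse y"

instance
proof
  fix a b :: residue
  show "a \<noteq> 0 \<Longrightarrow> inverse a * a = 1"
    by transfer (auto simp: zero_nonunit unit_nonzero inverse_unit)
  show "a div b = a * inverse b" by (rule divide_residue_def)
  show "inverse (0 :: residue) = 0" by transfer (simp add: zero_nonunit)
qed

end

lemma residue_class_hom:
  "residue_class 0 = 0" "residue_class 1 = 1"
  "x \<in> vring \<Longrightarrow> y \<in> vring \<Longrightarrow> residue_class (x + y) = residue_class x + residue_class y"
  "x \<in> vring \<Longrightarrow> y \<in> vring \<Longrightarrow> residue_class (x - y) = residue_class x - residue_class y"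
  "x \<in> vring \<Longrightarrow> y \<in> vring \<Longrightarrow> residue_class (x * y) = residue_class x * residue_class y"
  "x \<in> vring \<Longrightarrow> residue_class (- x) = - residue_class x"
  subgoal by (simp add: zero_residue_def)
  subgoal by (simp add: one_residue_def)
  subgoal by (simp add: plus_residue.abs_eq zero_nonunit)
  subgoal by (simp add: minus_residue.abs_eq zero_nonunit)
  subgoal by (simp add: times_residue.abs_eq zero_nonunit)
  subgoal by (simp add: uminus_residue.abs_eq zero_nonunit)
  done

lemma residue_class_power: "x \<in> vring \<Longrightarrow> residue_class (x ^ n) = residue_class x ^ n \<and> x ^ n \<in> vring"
  by (induction n) (auto simp: residue_class_hom)

lemma residue_class_surj: "\<exists>x\<in>vring. residue_class x = a"
  by (induction a rule: residue.abs_induct) auto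

lemma residue_three: "(3 :: residue) = 0"
proof -
  have "(1 + 1 + 1 :: residue) = 0"
    by transfer (use three_nonunit vring.pi in simp)
  then show ?thesis by simp
qed

text \<open>
  A nonzero vector can be divided by a coordinate of largest absolute value in the sense of the
  valuation. The result has a nonzero reduction; this is why projective points and linear spaces
  specialise.
\<close>

lemma primitive_multiple:
  fixes v :: "complex ^ 'n::finite"
  assumes "v \<noteq> 0"
  shows "\<exists>c. c \<noteq> 0 \<and> (\<forall>i. c * v $ i \<in> vring) \<and> (\<exists>i. c * v $ i = 1)"
proof -
  have "\<exists>i\<in>I. v $ i \<noteq> 0 \<and> (\<forall>j\<in>I. v $ j / v $ i \<in> vring)"
    if "finite I" "\<exists>i\<in>I. v $ i \<noteq> 0" for I
    using that
  proof (induction I)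
    case (insert k I)
    show ?case
    proof (cases "\<exists>i\<in>I. v $ i \<noteq> 0")
      case False
      then have "v $ k \<noteq> 0" "\<forall>j\<in>I. v $ j = 0" using insert.prems by auto
      then show ?thesis by auto
    next
      case True
      then obtain i where i: "i \<in> I" "v $ i \<noteq> 0" "\<And>j. j \<in> I \<Longrightarrow> v $ j / v $ i \<in> vring"
        using insert.IH by blast
      show ?thesis
      proof (cases "v $ k / v $ i \<in> vring")
        case True
        then show ?thesis using i by blast
      next
        case False
        then have k: "v $ k \<noteq> 0" by (metis div_0 vring_closed(2))
        have ki: "v $ i / v $ k \<in> vring"
          using vring.valuation[of "v $ k / v $ i"] False by (simp add: inverse_eq_divide)
        have "v $ j / v $ k \<in> vring" if "j \<in> I" for j
        proof -
          have "v $ j / v $ k = (v $ j / v $ i) * (v $ i / v $ k)" using i by simp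
          then show ?thesis using i(3)[OF that] ki by (metis vring_closed(6))
        qed
        then show ?thesis using k by auto
      qed
    qed
  qed auto
  from this[of UNIV] obtain i where i: "v $ i \<noteq> 0" "\<And>j. v $ j / v $ i \<in> vring"
    using assms by (auto simp: vec_eq_iff)
  show ?thesis
    using i by (intro exI[of _ "inverse (v $ i)"]) (auto simp: field_simps intro!: exI[of _ i])
qed

section \<open>The cubic in characteristic 3\<close>

text \<open>
  The equation of the threefold uses the coordinates 0 to 4 of \<open>k^6\<close>; coordinate 5 is the direction of
  the triple cover. \<open>cubic_polar p q\<close> is the derivative of the cubic at p in the direction q.
\<close>

definition cubic :: "'a::comm_ring_1 ^ 6 \<Rightarrow> 'a" where
  "cubic p = p$2 * (p$1)\<^sup>2 + p$0 * (p$2)\<^sup>2 - (p$0)\<^sup>2 * p$4 + (p$0)\<^sup>2 * p$2 - p$3 * (p$4)\<^sup>2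
    + p$0 * p$1 * p$3 - (p$3)^3"

definition cubic_polar :: "'a::comm_ring_1 ^ 6 \<Rightarrow> 'a ^ 6 \<Rightarrow> 'a" where
  "cubic_polar p q = ((p$2)\<^sup>2 - 2 * p$0 * p$4 + 2 * p$0 * p$2 + p$1 * p$3) * q$0
    + (2 * p$2 * p$1 + p$0 * p$3) * q$1 + ((p$1)\<^sup>2 + 2 * p$0 * p$2 + (p$0)\<^sup>2) * q$2
    + (- (p$4)\<^sup>2 + p$0 * p$1 - 3 * (p$3)\<^sup>2) * q$3 + (- (p$0)\<^sup>2 - 2 * p$3 * p$4) * q$4"

definition fourfold :: "'a::comm_ring_1 ^ 6 \<Rightarrow> 'a" where
  "fourfold p = cubic p + (p$5)^3"

lemma cubic_expand:
  "cubic (p + s *s q) = cubic p + s * cubic_polar p q + s\<^sup>2 * cubic_polar q p + s^3 * cubic q"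
  by (simp add: cubic_def cubic_polar_def power2_eq_square power3_eq_cube algebra_simps)

lemma cubic_polar_char3:
  fixes p q :: "'k::field ^ 6"
  assumes "(3::'k) = 0"
  shows "cubic_polar p q = ((p$2)\<^sup>2 + p$0 * p$4 - p$0 * p$2 + p$1 * p$3) * q$0
    + (- (p$2 * p$1) + p$0 * p$3) * q$1 + ((p$1)\<^sup>2 - p$0 * p$2 + (p$0)\<^sup>2) * q$2
    + (- (p$4)\<^sup>2 + p$0 * p$1) * q$3 + (- (p$0)\<^sup>2 + p$3 * p$4) * q$4"
proof -
  have "(2::'k) = 3 - 1" by simp
  then have two: "(2::'k) = -1" unfolding assms by simp
  show ?thesis unfolding cubic_polar_def assms two by simp
qed

text \<open>
  With the coordinates x, y, z, w, v: if x vanishes, the derivatives kill all coordinates but w, and \<open>f = - w^3\<close>.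
  Otherwise the derivatives collapse f to \<open>x z^2\<close>, so that z, then w, then x vanish.
\<close>

lemma smooth_char3:
  fixes p :: "'k::field ^ 6"
  assumes three: "(3::'k) = 0" and p: "cubic p = 0" and polar: "\<And>q. cubic_polar p q = 0"
  shows "p$0 = 0 \<and> p$1 = 0 \<and> p$2 = 0 \<and> p$3 = 0 \<and> p$4 = 0"
proof -
  define x y z w v where xyz: "x = p$0" "y = p$1" "z = p$2" "w = p$3" "v = p$4"
  note D = polar[unfolded cubic_polar_char3[OF three], folded xyz]
  have e0: "z\<^sup>2 + x * v - x * z + y * w = 0" using D[of "axis 0 1"] by (simp add: axis_def)
  have e1: "x * w = z * y" using D[of "axis 1 1"] by (simp add: axis_def)
  have e2: "y\<^sup>2 - x * z + x\<^sup>2 = 0" using D[of "axis 2 1"] by (simp add: axis_def)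
  have e3: "x * y = v\<^sup>2" using D[of "axis 3 1"] by (simp add: axis_def)
  have e4: "x\<^sup>2 = w * v" using D[of "axis 4 1"] by (simp add: axis_def)
  have F: "z * y\<^sup>2 + x * z\<^sup>2 - x\<^sup>2 * v + x\<^sup>2 * z - w * v\<^sup>2 + x * y * w - w^3 = 0"
    using p unfolding cubic_def xyz by simp
  have x0: "x = 0"
  proof (rule ccontr)
    assume x: "x \<noteq> 0"
    then have v: "v \<noteq> 0" using e4 by auto
    have "v\<^sup>2 * (x\<^sup>2 * z - w^3) = 0" using e1 e3 e4 by algebra
    then have a: "x\<^sup>2 * z - w^3 = 0" using v by simp
    have "z * y\<^sup>2 = x * y * w" "x * y * w = x\<^sup>2 * v" "w * v\<^sup>2 = x\<^sup>2 * v"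
      using e1 e3 e4 by algebra+
    then have "x * z\<^sup>2 = 0" using F a by (simp add: algebra_simps)
    then have "z = 0" using x by simp
    then have "w = 0" using e1 x by simp
    then show False using e4 x by simp
  qed
  then have "v = 0" using e3 by simp
  moreover have "y = 0" using e2 x0 by simp
  moreover have "z = 0" using e0 x0 \<open>y = 0\<close> by simp
  moreover have "w = 0" using F x0 calculation by simp
  ultimately show ?thesis using x0 xyz by simp
qed

text \<open>
  Planes on \<open>f + t^3 = 0\<close> in characteristic 3. Cubing is additive there, so \<open>t^3\<close> contributes nothing to
  the mixed terms of \<open>f(p + s q) + t(p + s q)^3\<close>, and on a linear space S contained in the fourfold
  the derivative of f at any point of S vanishes in all directions of S. That S is at least
  three-dimensional enters only through the existence of nonzero vectors with two prescribed zero
  coordinates. Choosing such vectors with many zeros makes the bilinear conditions so simple that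
  they force, one after the other, more coordinates to vanish on all of S, or on its part where the
  first coordinate is zero.
\<close>

lemma no_plane_char3:
  fixes S :: "('k::field ^ 6) set"
  assumes three: "(3::'k) = 0"
    and add: "\<And>p q. p \<in> S \<Longrightarrow> q \<in> S \<Longrightarrow> p + q \<in> S"
    and scale: "\<And>c p. p \<in> S \<Longrightarrow> c *s p \<in> S"
    and kill: "\<And>i j. \<exists>r\<in>S. r \<noteq> 0 \<and> r $ i = 0 \<and> r $ j = 0"
    and zero: "\<And>p. p \<in> S \<Longrightarrow> fourfold p = 0"
  shows False
proof -
  have polar: "cubic_polar p q = 0" if S: "p \<in> S" "q \<in> S" for p q
  proof -
    have two: "(2::'k) \<noteq> 0"
    proof
      assume "(2::'k) = 0"
      then have "(3::'k) - 2 = 0" using three by simp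
      then show False by simp
    qed
    have "fourfold (p + 1 *s q) = 0" "fourfold (p + (-1) *s q) = 0" "fourfold q = 0"
      using S add scale zero by blast+
    moreover have "fourfold (p + 1 *s q) - fourfold (p + (-1) *s q) - 2 * fourfold q
        = 2 * cubic_polar p q + 3 * (2 * (p$5)\<^sup>2 * q$5)"
      unfolding fourfold_def cubic_expand by (simp add: power2_eq_square power3_eq_cube algebra_simps)
    ultimately show ?thesis using three two by simp
  qed
  note D = polar[unfolded cubic_polar_char3[OF three]]
  have nonzero: "p = 0" if "p \<in> S" "p$0 = 0" "p$1 = 0" "p$2 = 0" "p$3 = 0" "p$4 = 0" for p
  proof -
    have "(p$5)^3 = 0" using zero[OF that(1)] that by (simp add: fourfold_def cubic_def)
    then have "p$5 = 0" by simp
    then show ?thesis using that by (simp add: vec_eq_iff all_6)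
  qed
  show False
  proof (cases "\<exists>p\<in>S. p$0 \<noteq> 0")
    case False
    then have S0: "q$0 = 0" if "q \<in> S" for q using that by blast
    obtain r where r: "r \<in> S" "r \<noteq> 0" "r$1 = 0" "r$3 = 0" using kill by blast
    have r24: "r$2 \<noteq> 0 \<or> r$4 \<noteq> 0" using nonzero r S0 by blast
    have q3: "(r$4)\<^sup>2 * q$3 = 0" if "q \<in> S" for q
      using D[OF r(1) that] r S0 that by simp
    have q13: "(q$1)\<^sup>2 * r$2 + q$3 * q$4 * r$4 = 0" if "q \<in> S" for q
      using D[OF that r(1)] r S0 that by simp
    show False
    proof (cases "r$4 = 0")
      case True
      then have S1: "q$1 = 0" if "q \<in> S" for q using q13[OF that] r24 by simp
      obtain s where s: "s \<in> S" "s \<noteq> 0" "s$2 = 0" "s$4 = 0" using kill by blast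
      then have s3: "s$3 \<noteq> 0" using nonzero S0 S1 by blast
      have S4: "q$4 = 0" if "q \<in> S" for q
        using D[OF that s(1)] s s3 S0 S1 that by simp
      obtain t where "t \<in> S" "t \<noteq> 0" "t$2 = 0" "t$3 = 0" using kill by blast
      then show False using nonzero S0 S1 S4 by blast
    next
      case False
      then have S3: "q$3 = 0" if "q \<in> S" for q using q3[OF that] by simp
      obtain s where s: "s \<in> S" "s \<noteq> 0" "s$1 = 0" "s$4 = 0" using kill by blast
      then have s2: "s$2 \<noteq> 0" using nonzero S0 S3 by blast
      have S1: "q$1 = 0" if "q \<in> S" for q
        using D[OF that s(1)] s s2 S0 S3 that by simp
      obtain t where "t \<in> S" "t \<noteq> 0" "t$2 = 0" "t$4 = 0" using kill by blast
      then show False using nonzero S0 S1 S3 by blast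
    qed
  next
    case True
    then obtain p' where "p' \<in> S" "p'$0 \<noteq> 0" by blast
    then have "inverse (p'$0) *s p' \<in> S" "(inverse (p'$0) *s p')$0 = 1" using scale by auto
    then obtain p where p: "p \<in> S" "p$0 = 1" by blast
    \<comment> \<open>with p available, coordinates 0, 1 and 4 already detect whether a vector of S is zero\<close>
    have no014: "r = 0" if r: "r \<in> S" "r$0 = 0" "r$1 = 0" "r$4 = 0" for r
    proof (rule ccontr)
      assume "r \<noteq> 0"
      have "r$2 = 0" using D[OF r(1) p(1)] r p by simp
      then have r3: "r$3 \<noteq> 0" using nonzero r \<open>r \<noteq> 0\<close> by blast
      have q4: "q$4 = 0" if "q \<in> S" "q$0 = 0" for q
        using D[OF that(1) r(1)] that r \<open>r$2 = 0\<close> r3 by simp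
      have eq: "(q$2)\<^sup>2 + q$1 * q$3 - q$2 * q$1 * p$1 + (q$1)\<^sup>2 * p$2 = 0" if "q \<in> S" "q$0 = 0" for q
        using D[OF that(1) p(1)] that q4 p by simp
      \<comment> \<open>compare the relation for q with the one for q + r\<close>
      have q1: "q$1 = 0" if "q \<in> S" "q$0 = 0" for q
      proof -
        have "q + r \<in> S" "(q + r)$0 = 0" using that r add by auto
        from eq[OF this]
        have "(q$2)\<^sup>2 + q$1 * (q$3 + r$3) - q$2 * q$1 * p$1 + (q$1)\<^sup>2 * p$2 = 0"
          using r \<open>r$2 = 0\<close> by simp
        with eq[OF that] have "q$1 * r$3 = 0" by algebra
        then show ?thesis using r3 by simp
      qed
      have q2: "q$2 = 0" if "q \<in> S" "q$0 = 0" for q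
        using eq[OF that] q1[OF that] by simp
      obtain t where "t \<in> S" "t \<noteq> 0" "t$0 = 0" "t$3 = 0" using kill by blast
      then show False using nonzero q1 q2 q4 by blast
    qed
    obtain r where r: "r \<in> S" "r \<noteq> 0" "r$0 = 0" "r$1 = 0" using kill by blast
    then have r4: "r$4 \<noteq> 0" using no014 by blast
    have ratio: "r$4 * q$3 = r$3 * q$4" and q1z: "(q$1)\<^sup>2 * r$2 = 0" if "q \<in> S" "q$0 = 0" for q
    proof -
      have "r$4 * (r$4 * q$3 - r$3 * q$4) = 0"
        using D[OF r(1) that(1)] r(3,4) that(2) by algebra
      then show *: "r$4 * q$3 = r$3 * q$4" using r4 by simp
      have "(q$1)\<^sup>2 * r$2 + q$4 * (r$4 * q$3 - r$3 * q$4) = 0"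
        using D[OF that(1) r(1)] r(3,4) that(2) by algebra
      then show "(q$1)\<^sup>2 * r$2 = 0" using * by simp
    qed
    \<comment> \<open>coordinate 1 vanishes with coordinate 0, so a vector without coordinates 0 and 4 contradicts no014\<close>
    have q1: "q$1 = 0" if q: "q \<in> S" "q$0 = 0" for q
    proof (cases "r$2 = 0")
      case False
      then show ?thesis using q1z[OF q] by simp
    next
      case True
      \<comment> \<open>coordinate 1 is constant where coordinate 0 is 1, so it vanishes where coordinate 0 does\<close>
      have rel: "p'$1 * r$3 = r$4" if p': "p' \<in> S" "p'$0 = 1" for p'
      proof -
        have "r$4 * (r$4 * p'$3 - r$3 * p'$4) = 0"
          using D[OF r(1) p'(1)] r(3,4) p'(2) True by algebra
        then have *: "r$4 * p'$3 = r$3 * p'$4" using r4 by simp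
        have "p'$1 * r$3 - r$4 + p'$4 * (r$4 * p'$3 - r$3 * p'$4) = 0"
          using D[OF p'(1) r(1)] r(3,4) p'(2) True by algebra
        then show ?thesis using * by simp
      qed
      have "p + q \<in> S" "(p + q)$0 = 1" using p q add by auto
      from rel[OF this] rel[OF p] have "q$1 * r$3 = 0" by (simp add: algebra_simps)
      moreover have "r$3 \<noteq> 0" using rel[OF p] r4 by auto
      ultimately show ?thesis by simp
    qed
    obtain s where "s \<in> S" "s \<noteq> 0" "s$0 = 0" "s$4 = 0" using kill by blast
    then show False using q1 no014 by blast
  qed
qed

section \<open>Specialisation from the complex numbers\<close>

definition integral_vec :: "complex ^ 'n::finite \<Rightarrow> bool" where
  "integral_vec v \<longleftrightarrow> (\<forall>i. v $ i \<in> vring)"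

definition reduce_vec :: "complex ^ 'n::finite \<Rightarrow> residue ^ 'n" where
  "reduce_vec v = (\<chi> i. residue_class (v $ i))"

lemma reduce_vec_nth [simp]: "reduce_vec v $ i = residue_class (v $ i)"
  by (simp add: reduce_vec_def)

lemma vring_numeral [simp, intro]: "numeral n \<in> vring"
proof -
  have "of_nat m \<in> vring" for m by (induction m) auto
  from this[of "numeral n"] show ?thesis by simp
qed

lemma residue_class_numeral: "residue_class (numeral n) = numeral n"
proof -
  have "residue_class (of_nat m) = of_nat m \<and> (of_nat m :: complex) \<in> vring" for m
    by (induction m) (auto simp: residue_class_hom)
  from this[of "numeral n"] show ?thesis by simp
qed

lemma vring_power [simp, intro]: "x \<in> vring \<Longrightarrow> x ^ n \<in> vring"
  and residue_class_power': "x \<in> vring \<Longrightarrow> residue_class (x ^ n) = residue_class x ^ n"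
  using residue_class_power by auto

lemmas residue_class_simps = residue_class_hom residue_class_power' residue_class_numeral

lemma reduce_polynomials:
  fixes p q :: "complex ^ 6"
  assumes "integral_vec p" "integral_vec q"
  shows "cubic (reduce_vec p) = residue_class (cubic p)"
    "cubic_polar (reduce_vec p) (reduce_vec q) = residue_class (cubic_polar p q)"
    "fourfold (reduce_vec p) = residue_class (fourfold p)"
proof -
  have [simp]: "p $ i \<in> vring" "q $ i \<in> vring" for i using assms by (auto simp: integral_vec_def)
  show "cubic (reduce_vec p) = residue_class (cubic p)"
    "cubic_polar (reduce_vec p) (reduce_vec q) = residue_class (cubic_polar p q)"
    "fourfold (reduce_vec p) = residue_class (fourfold p)"
    by (simp_all add: cubic_def cubic_polar_def fourfold_def residue_class_simps)
qed

lemma reduce_vec_surj: "\<exists>v. integral_vec v \<and> reduce_vec v = w"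
proof -
  have "\<exists>f. \<forall>i. f i \<in> vring \<and> residue_class (f i) = w $ i"
    using residue_class_surj by (intro choice) blast
  then obtain f where "\<And>i. f i \<in> vring \<and> residue_class (f i) = w $ i" by blast
  then show ?thesis
    by (intro exI[of _ "\<chi> i. f i"]) (auto simp: integral_vec_def vec_eq_iff)
qed

lemma cubic_scale:
  "cubic (c *s p) = c^3 * cubic p" "cubic_polar (c *s p) q = c\<^sup>2 * cubic_polar p q"
  "fourfold (c *s p) = c^3 * fourfold p"
  by (simp_all add: cubic_def cubic_polar_def fourfold_def power2_eq_square power3_eq_cube algebra_simps)

text \<open>
  A singular point, scaled to a primitive vector, reduces to a singular point in characteristic 3.
\<close>

theorem cubic_smooth:
  fixes p :: "complex ^ 6"
  assumes "cubic p = 0" "\<And>q. cubic_polar p q = 0"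
  shows "p$0 = 0 \<and> p$1 = 0 \<and> p$2 = 0 \<and> p$3 = 0 \<and> p$4 = 0"
proof (rule ccontr)
  assume nz: "\<not> ?thesis"
  \<comment> \<open>the cubic does not see coordinate 5, which must not become the unit coordinate after scaling\<close>
  define v where "v = (\<chi> i. if i = 5 then 0 else p $ i)"
  have nth: "v$0 = p$0" "v$1 = p$1" "v$2 = p$2" "v$3 = p$3" "v$4 = p$4" "v$5 = 0"
    by (simp_all add: v_def)
  have v: "cubic v = 0" "\<And>q. cubic_polar v q = 0"
    using assms by (simp_all add: cubic_def cubic_polar_def nth)
  have "v \<noteq> 0" using nz nth by (metis zero_index)
  then obtain c i where c: "c \<noteq> 0" "\<And>i. c * v $ i \<in> vring" "c * v $ i = 1"
    using primitive_multiple[of v] by blast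
  define u where "u = c *s v"
  have int: "integral_vec u" using c by (simp add: u_def integral_vec_def)
  have "cubic (reduce_vec u) = 0"
    using v int by (simp add: reduce_polynomials u_def cubic_scale residue_class_hom)
  moreover have "cubic_polar (reduce_vec u) w = 0" for w
  proof -
    obtain q where "integral_vec q" "reduce_vec q = w" using reduce_vec_surj by blast
    then show ?thesis
      using v int by (auto simp: reduce_polynomials u_def cubic_scale residue_class_hom)
  qed
  ultimately have "reduce_vec u $ 0 = 0 \<and> reduce_vec u $ 1 = 0 \<and> reduce_vec u $ 2 = 0 \<and>
    reduce_vec u $ 3 = 0 \<and> reduce_vec u $ 4 = 0"
    by (intro smooth_char3 residue_three)
  moreover have "u $ 5 = 0" by (simp add: u_def nth)
  ultimately have "\<forall>i. reduce_vec u $ i = 0"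
    unfolding all_6 by (simp add: residue_class_hom)
  moreover have "reduce_vec u $ i = 1" using c(3) by (simp add: u_def residue_class_hom)
  ultimately show False by simp
qed

lemma dim_kernel_ge:
  fixes M :: "('a::field ^ 'n::finite) set" and \<phi> :: "'a ^ 'n \<Rightarrow> 'a"
  assumes M: "vec.subspace M"
    and add: "\<And>x y. \<phi> (x + y) = \<phi> x + \<phi> y" and scale: "\<And>c x. \<phi> (c *s x) = c * \<phi> x"
  shows "vec.subspace {m\<in>M. \<phi> m = 0} \<and> vec.dim M \<le> vec.dim {m\<in>M. \<phi> m = 0} + 1"
proof
  have zero: "\<phi> 0 = 0" using scale[of 0 0] by simp
  show sub: "vec.subspace {m\<in>M. \<phi> m = 0}"
    using M zero by (auto simp: vec.subspace_def add scale)
  show "vec.dim M \<le> vec.dim {m\<in>M. \<phi> m = 0} + 1"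
  proof (cases "\<forall>m\<in>M. \<phi> m = 0")
    case True
    then have "{m\<in>M. \<phi> m = 0} = M" by auto
    then show ?thesis by simp
  next
    case False
    then obtain p where p: "p \<in> M" "\<phi> p \<noteq> 0" by blast
    have "M \<subseteq> vec.span (insert p {m\<in>M. \<phi> m = 0})"
    proof
      fix m assume m: "m \<in> M"
      define k where "k = m - (\<phi> m / \<phi> p) *s p"
      have "\<phi> (k + (\<phi> m / \<phi> p) *s p) = \<phi> m" by (simp add: k_def)
      then have "\<phi> k = 0" using p by (simp add: add scale)
      moreover have "k \<in> M" unfolding k_def using m p M by (intro vec.subspace_diff vec.subspace_scale)
      ultimately have k: "k \<in> vec.span (insert p {m\<in>M. \<phi> m = 0})"
        by (intro vec.span_base) auto
      have "p \<in> vec.span (insert p {m\<in>M. \<phi> m = 0})" by (intro vec.span_base) auto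
      then have "k + (\<phi> m / \<phi> p) *s p \<in> vec.span (insert p {m\<in>M. \<phi> m = 0})"
        using k by (intro vec.span_add vec.span_scale)
      then show "m \<in> vec.span (insert p {m\<in>M. \<phi> m = 0})" by (simp add: k_def)
    qed
    then have "vec.dim M \<le> vec.dim (insert p {m\<in>M. \<phi> m = 0})"
      using vec.dim_subset vec.dim_span by metis
    then show ?thesis by (auto simp: vec.dim_insert split: if_splits)
  qed
qed

lemma dim_pos_nonzero:
  assumes "vec.dim (M :: ('a::field ^ 'n::finite) set) > 0"
  shows "\<exists>m\<in>M. m \<noteq> 0"
proof (rule ccontr)
  assume "\<not> ?thesis"
  then have "M \<subseteq> {0}" by auto
  then have "vec.dim M = 0" by (simp only: vec.dim_eq_0)
  then show False using assms by linarith
qed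

text \<open>
  The integral vectors of M reduce to a linear space in the fourfold over the residue field. Its
  dimension need not be computed: two coordinates can be made zero by a nonzero vector of M, and a
  primitive multiple of that vector keeps a nonzero reduction.
\<close>

theorem fourfold_no_plane:
  fixes M :: "(complex ^ 6) set"
  assumes M: "vec.subspace M" "vec.dim M \<ge> 3" and zero: "\<And>m. m \<in> M \<Longrightarrow> fourfold m = 0"
  shows False
proof -
  define S where "S = reduce_vec ` {m\<in>M. integral_vec m}"
  show False
  proof (rule no_plane_char3[OF residue_three, of S])
    fix p q assume "p \<in> S" "q \<in> S"
    then obtain m n where mn: "m \<in> M" "n \<in> M" "integral_vec m" "integral_vec n"
      "p = reduce_vec m" "q = reduce_vec n" by (auto simp: S_def)
    then have "p + q = reduce_vec (m + n)" "integral_vec (m + n)"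
      by (auto simp: vec_eq_iff residue_class_hom integral_vec_def)
    then show "p + q \<in> S" using mn M vec.subspace_add by (auto simp: S_def)
  next
    fix c p assume "p \<in> S"
    then obtain m where m: "m \<in> M" "integral_vec m" "p = reduce_vec m" by (auto simp: S_def)
    obtain a where a: "a \<in> vring" "residue_class a = c" using residue_class_surj by metis
    have "c *s p = reduce_vec (a *s m)" "integral_vec (a *s m)"
      using a m by (auto simp: vec_eq_iff residue_class_hom integral_vec_def)
    then show "c *s p \<in> S" using m M vec.subspace_scale by (auto simp: S_def)
  next
    fix p assume "p \<in> S"
    then show "fourfold p = 0" using zero by (auto simp: S_def reduce_polynomials residue_class_hom)
  next
    fix i j
    have "vec.subspace {m\<in>M. m $ i = 0}" "vec.dim M \<le> vec.dim {m\<in>M. m $ i = 0} + 1"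
      using dim_kernel_ge[OF M(1), of "\<lambda>m. m $ i"] by auto
    moreover from this(1) have
      "vec.dim {m\<in>M. m $ i = 0} \<le> vec.dim {m\<in>{m\<in>M. m $ i = 0}. m $ j = 0} + 1"
      using dim_kernel_ge[of "{m\<in>M. m $ i = 0}" "\<lambda>m. m $ j"] by auto
    ultimately have "vec.dim {m\<in>{m\<in>M. m $ i = 0}. m $ j = 0} > 0" using M(2) by linarith
    then obtain m where m: "m \<in> M" "m \<noteq> 0" "m $ i = 0" "m $ j = 0"
      using dim_pos_nonzero by blast
    obtain c k where c: "c \<noteq> 0" "\<And>i. c * m $ i \<in> vring" "c * m $ k = 1"
      using primitive_multiple[OF m(2)] by metis
    have "c *s m \<in> M" using m M vec.subspace_scale by blast
    then have "reduce_vec (c *s m) \<in> S" using c by (auto simp: S_def integral_vec_def)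
    moreover have "reduce_vec (c *s m) $ k \<noteq> 0" using c by (simp add: residue_class_hom)
    then have "reduce_vec (c *s m) \<noteq> 0" by (metis zero_index)
    moreover have "reduce_vec (c *s m) $ i = 0" "reduce_vec (c *s m) $ j = 0"
      using m by (simp_all add: residue_class_hom)
    ultimately show "\<exists>r\<in>S. r \<noteq> 0 \<and> r $ i = 0 \<and> r $ j = 0" by blast
  qed
qed

section \<open>The linear system of forms and its annihilator\<close>

abbreviation elementary :: "6 \<Rightarrow> 6 \<Rightarrow> 'a::field_char_0 array6" where
  "elementary i j \<equiv> wedge (axis i 1) (axis j 1)"

text \<open>
  In 3 by 3 blocks this is the skew matrix with diagonal blocks X, Y and upper right block
  \<open>Z + x\<^sub>5 I\<close>, where X and Y are the skew matrices of the vectors \<open>\<xi> = (x\<^sub>1, 0, x\<^sub>4)\<close> and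
  \<open>\<upsilon> = (x\<^sub>4, - x\<^sub>0, - x\<^sub>1)\<close>, a vector a having the entries \<open>a\<^sub>3, - a\<^sub>2, a\<^sub>1\<close> above the diagonal, and Z has the rows \<open>(0, x\<^sub>3, x\<^sub>2)\<close>, \<open>(- x\<^sub>0 - x\<^sub>2, 0, - x\<^sub>3)\<close>, \<open>(x\<^sub>3, - x\<^sub>0, 0)\<close>.
  The Pfaffian of such a matrix is \<open>\<xi> \<sqdot> (Z + t I) \<upsilon> - det (Z + t I)\<close> with \<open>t = x\<^sub>5\<close>. As a polynomial in t
  it has no terms in \<open>t^2\<close> and t because the trace of Z, the sum of its principal 2 by 2 minors and
  \<open>\<xi> \<sqdot> \<upsilon>\<close> all vanish identically; this is what produces a cyclic triple cover.
\<close>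

definition pfaffian_form :: "'a::field_char_0 ^ 6 \<Rightarrow> 'a array6" where
  "pfaffian_form x = x$0 *s (elementary 3 5 - elementary 1 3 - elementary 2 4)
    + x$1 *s (elementary 1 2 - elementary 3 4) + x$2 *s (elementary 0 5 - elementary 1 3)
    + x$3 *s (elementary 0 4 - elementary 1 5 + elementary 2 3)
    + x$4 *s (elementary 0 1 + elementary 4 5)
    + x$5 *s (elementary 0 3 + elementary 1 4 + elementary 2 5)"

text \<open>
  Parametrises the bivectors orthogonal to all these forms: the six equations that define them have
  been solved for six of the fifteen coordinates.
\<close>

definition dual_bivector :: "'a::field_char_0 ^ 9 \<Rightarrow> 'a array6" where
  "dual_bivector y = y$0 *s (elementary 0 1 - elementary 4 5) + y$1 *s elementary 0 2
    + y$2 *s (elementary 1 2 + elementary 3 4)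
    + y$3 *s (elementary 1 3 + elementary 0 5 - elementary 2 4)
    + y$4 *s (elementary 0 3 - elementary 2 5) + y$5 *s (elementary 0 4 - elementary 2 3)
    + y$6 *s (elementary 1 4 - elementary 2 5) + y$7 *s (elementary 1 5 + elementary 2 3)
    + y$8 *s (elementary 3 5 + elementary 2 4)"

lemma axis_component: "axis i c $ k = (if k = i then c else 0)"
  by (simp add: axis_def)

lemma elementary_nth:
  "elementary i j $ (k, l) = axis i 1 $ k * axis j 1 $ l - axis i 1 $ l * axis j 1 $ k"
  by (simp add: wedge_def)

lemma pfaffian_form_nth:
  "pfaffian_form x $ (0,1) = x$4" "pfaffian_form x $ (0,2) = 0" "pfaffian_form x $ (0,3) = x$5"
  "pfaffian_form x $ (0,4) = x$3" "pfaffian_form x $ (0,5) = x$2" "pfaffian_form x $ (1,2) = x$1"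
  "pfaffian_form x $ (1,3) = - x$0 - x$2" "pfaffian_form x $ (1,4) = x$5"
  "pfaffian_form x $ (1,5) = - x$3" "pfaffian_form x $ (2,3) = x$3"
  "pfaffian_form x $ (2,4) = - x$0" "pfaffian_form x $ (2,5) = x$5"
  "pfaffian_form x $ (3,4) = - x$1" "pfaffian_form x $ (3,5) = x$0" "pfaffian_form x $ (4,5) = x$4"
  by (simp_all add: pfaffian_form_def elementary_nth axis_component)

lemma dual_bivector_nth:
  "dual_bivector y $ (0,1) = y$0" "dual_bivector y $ (0,2) = y$1" "dual_bivector y $ (0,3) = y$4"
  "dual_bivector y $ (0,4) = y$5" "dual_bivector y $ (0,5) = y$3" "dual_bivector y $ (1,2) = y$2"
  "dual_bivector y $ (1,3) = y$3" "dual_bivector y $ (1,4) = y$6" "dual_bivector y $ (1,5) = y$7"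
  "dual_bivector y $ (2,3) = y$7 - y$5" "dual_bivector y $ (2,4) = y$8 - y$3"
  "dual_bivector y $ (2,5) = - y$4 - y$6" "dual_bivector y $ (3,4) = y$2"
  "dual_bivector y $ (3,5) = y$8" "dual_bivector y $ (4,5) = - y$0"
  by (simp_all add: dual_bivector_def elementary_nth axis_component)

lemma skew_elementary: "elementary i j \<in> skew"
  by (simp add: skew_def elementary_nth)

lemma subspace_skew: "vec.subspace skew"
  unfolding vec.subspace_def
proof (intro conjI ballI allI)
  show "0 \<in> skew" by (simp add: skew_def)
next
  fix a b :: "'a array6" assume ab: "a \<in> skew" "b \<in> skew"
  have "(a + b) $ (i, j) = - (a + b) $ (j, i)" for i j
    using skewD[OF ab(1), of i j] skewD[OF ab(2), of i j] by simp
  then show "a + b \<in> skew" unfolding skew_def by blast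
next
  fix c :: 'a and a :: "'a array6" assume a: "a \<in> skew"
  have "(c *s a) $ (i, j) = - (c *s a) $ (j, i)" for i j
    using skewD[OF a, of i j] by simp
  then show "c *s a \<in> skew" unfolding skew_def by blast
qed

lemma pfaffian_form_skew [simp]: "pfaffian_form x \<in> skew"
  unfolding pfaffian_form_def using subspace_skew skew_elementary
  by (intro vec.subspace_add vec.subspace_diff vec.subspace_scale)

lemma dual_bivector_skew [simp]: "dual_bivector y \<in> skew"
  unfolding dual_bivector_def using subspace_skew skew_elementary
  by (intro vec.subspace_add vec.subspace_diff vec.subspace_scale)

lemma linear_coordinate: "Vector_Spaces.linear (*s) (*s) (\<lambda>x. x $ i *s a)"
  by unfold_locales (simp_all add: vec.scale_left_distrib vec.scale_right_distrib)

lemma linear_pfaffian_form: "Vector_Spaces.linear (*s) (*s) pfaffian_form"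
  unfolding pfaffian_form_def[abs_def] by (intro vec.linear_compose_add linear_coordinate)

lemma linear_dual_bivector: "Vector_Spaces.linear (*s) (*s) dual_bivector"
  unfolding dual_bivector_def[abs_def] by (intro vec.linear_compose_add linear_coordinate)

lemma pf_pfaffian_form: "pf (pfaffian_form x) = - fourfold x"
  by (simp add: pf_def pf4_def pfaffian_form_nth fourfold_def cubic_def power2_eq_square power3_eq_cube
      algebra_simps)

lemma skew_eqI:
  assumes "a \<in> skew" "b \<in> skew"
    and "a$(0,1) = b$(0,1)" "a$(0,2) = b$(0,2)" "a$(0,3) = b$(0,3)" "a$(0,4) = b$(0,4)"
      "a$(0,5) = b$(0,5)" "a$(1,2) = b$(1,2)" "a$(1,3) = b$(1,3)" "a$(1,4) = b$(1,4)"
      "a$(1,5) = b$(1,5)" "a$(2,3) = b$(2,3)" "a$(2,4) = b$(2,4)" "a$(2,5) = b$(2,5)"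
      "a$(3,4) = b$(3,4)" "a$(3,5) = b$(3,5)" "a$(4,5) = b$(4,5)"
  shows "a = b"
proof -
  have sw: "a $ (j, i) = b $ (j, i)" if "a $ (i, j) = b $ (i, j)" for i j
    using that skewD[OF assms(1), of j i] skewD[OF assms(2), of j i] by simp
  have dg: "a $ (i, i) = b $ (i, i)" for i
    using skew_diag[OF assms(1)] skew_diag[OF assms(2)] by simp
  have "\<forall>i j. a $ (i, j) = b $ (i, j)"
    unfolding all_6 by (simp add: dg assms(3-) assms(3-)[THEN sw])
  then show ?thesis by (simp add: vec_eq_iff)
qed

lemma pairing_skew:
  assumes "a \<in> skew" "b \<in> skew"
  shows "(\<Sum>p\<in>UNIV. a $ p * b $ p) = 2 * (a$(0,1) * b$(0,1) + a$(0,2) * b$(0,2) + a$(0,3) * b$(0,3)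
    + a$(0,4) * b$(0,4) + a$(0,5) * b$(0,5) + a$(1,2) * b$(1,2) + a$(1,3) * b$(1,3)
    + a$(1,4) * b$(1,4) + a$(1,5) * b$(1,5) + a$(2,3) * b$(2,3) + a$(2,4) * b$(2,4)
    + a$(2,5) * b$(2,5) + a$(3,4) * b$(3,4) + a$(3,5) * b$(3,5) + a$(4,5) * b$(4,5))"
proof -
  have sw: "a $ (j, i) * b $ (j, i) = a $ (i, j) * b $ (i, j)" for i j
    using skewD[OF assms(1), of j i] skewD[OF assms(2), of j i] by simp
  have "(\<Sum>p\<in>UNIV. a $ p * b $ p) = (\<Sum>i\<in>UNIV. \<Sum>j\<in>UNIV. a $ (i, j) * b $ (i, j))"
    by (simp add: sum.cartesian_product UNIV_Times_UNIV[symmetric] del: UNIV_Times_UNIV)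
  then show ?thesis
    by (simp add: sum_6 skew_diag[OF assms(1)] sw[of 1 0] sw[of 2 0] sw[of 3 0] sw[of 4 0] sw[of 5 0]
        sw[of 2 1] sw[of 3 1] sw[of 4 1] sw[of 5 1] sw[of 3 2] sw[of 4 2] sw[of 5 2] sw[of 4 3]
        sw[of 5 3] sw[of 5 4])
qed

lemma double_eq_0_iff: "2 * x = 0 \<longleftrightarrow> x = (0::'a::field_char_0)"
  by simp

lemma inj_pfaffian_form: "inj pfaffian_form"
proof (rule injI)
  fix x y :: "'a ^ 6" assume "pfaffian_form x = pfaffian_form y"
  then have e: "pfaffian_form x $ p = pfaffian_form y $ p" for p by simp
  show "x = y"
    using e[of "(0,1)"] e[of "(1,2)"] e[of "(0,3)"] e[of "(0,4)"] e[of "(0,5)"] e[of "(3,5)"]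
    by (simp add: pfaffian_form_nth vec_eq_iff all_6)
qed

lemma UNIV_9: "(UNIV :: 9 set) = {0, 1, 2, 3, 4, 5, 6, 7, 8}"
proof -
  have "card {0, 1, 2, 3, 4, 5, 6, 7, 8 :: 9} = card (UNIV :: 9 set)" by simp
  then show ?thesis
    using card_subset_eq[of UNIV "{0, 1, 2, 3, 4, 5, 6, 7, 8 :: 9}"] by simp
qed

lemma inj_dual_bivector: "inj dual_bivector"
proof (rule injI)
  fix x y :: "'a ^ 9" assume "dual_bivector x = dual_bivector y"
  then have e: "dual_bivector x $ p = dual_bivector y $ p" for p by simp
  have "\<forall>i\<in>{0, 1, 2, 3, 4, 5, 6, 7, 8 :: 9}. x $ i = y $ i"
    using e[of "(0,1)"] e[of "(0,2)"] e[of "(1,2)"] e[of "(1,3)"] e[of "(0,3)"] e[of "(0,4)"] e[of "(1,4)"]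
      e[of "(1,5)"] e[of "(3,5)"]
    by (simp add: dual_bivector_nth)
  then show "x = y" unfolding UNIV_9[symmetric] by (simp add: vec_eq_iff)
qed

lemma annihilator_pfaffian_form:
  "annihilator (range pfaffian_form) = range (dual_bivector :: 'a::field_char_0 ^ 9 \<Rightarrow> _)"
proof
  show "range dual_bivector \<subseteq> annihilator (range (pfaffian_form :: 'a ^ 6 \<Rightarrow> _))"
    by (auto simp: annihilator_def pairing_skew pfaffian_form_nth dual_bivector_nth algebra_simps)
  show "annihilator (range pfaffian_form) \<subseteq> range (dual_bivector :: 'a ^ 9 \<Rightarrow> _)"
  proof
    fix b :: "'a array6" assume "b \<in> annihilator (range pfaffian_form)"
    then have b: "b \<in> skew" and "(\<Sum>p\<in>UNIV. pfaffian_form x $ p * b $ p) = 0" for x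
      by (auto simp: annihilator_def)
    note pair = this(2)[unfolded pairing_skew[OF pfaffian_form_skew b] pfaffian_form_nth double_eq_0_iff]
    define y :: "'a ^ 9" where "y = (\<chi> i. if i = 0 then b$(0,1) else if i = 1 then b$(0,2)
      else if i = 2 then b$(1,2) else if i = 3 then b$(1,3) else if i = 4 then b$(0,3)
      else if i = 5 then b$(0,4) else if i = 6 then b$(1,4) else if i = 7 then b$(1,5) else b$(3,5))"
    have "b = dual_bivector y"
    proof (rule skew_eqI[OF b dual_bivector_skew], unfold dual_bivector_nth)
    qed (use pair[of "axis 0 1"] pair[of "axis 1 1"] pair[of "axis 2 1"] pair[of "axis 3 1"]
        pair[of "axis 4 1"] pair[of "axis 5 1"] in \<open>simp_all add: y_def axis_component algebra_simps add_eq_0_iff\<close>)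
    then show "b \<in> range dual_bivector" by blast
  qed
qed

lemma annihilator_dual_bivector:
  "annihilator (range dual_bivector) = range (pfaffian_form :: 'a::field_char_0 ^ 6 \<Rightarrow> _)"
proof
  show "range pfaffian_form \<subseteq> annihilator (range (dual_bivector :: 'a ^ 9 \<Rightarrow> _))"
    by (auto simp: annihilator_def pairing_skew pfaffian_form_nth dual_bivector_nth algebra_simps)
  show "annihilator (range dual_bivector) \<subseteq> range (pfaffian_form :: 'a ^ 6 \<Rightarrow> _)"
  proof
    fix b :: "'a array6" assume "b \<in> annihilator (range dual_bivector)"
    then have b: "b \<in> skew" and "(\<Sum>p\<in>UNIV. dual_bivector x $ p * b $ p) = 0" for x
      by (auto simp: annihilator_def)
    note pair = this(2)[unfolded pairing_skew[OF dual_bivector_skew b] dual_bivector_nth double_eq_0_iff]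
    define y :: "'a ^ 6" where "y = (\<chi> i. if i = 0 then b$(3,5) else if i = 1 then b$(1,2)
      else if i = 2 then b$(0,5) else if i = 3 then b$(0,4) else if i = 4 then b$(0,1) else b$(0,3))"
    have "b = pfaffian_form y"
    proof (rule skew_eqI[OF b pfaffian_form_skew], unfold pfaffian_form_nth)
    qed (use pair[of "axis 0 1"] pair[of "axis 1 1"] pair[of "axis 2 1"] pair[of "axis 3 1"]
        pair[of "axis 4 1"] pair[of "axis 5 1"] pair[of "axis 6 1"] pair[of "axis 7 1"] pair[of "axis 8 1"]
        in \<open>simp_all add: y_def axis_component algebra_simps add_eq_0_iff\<close>)
    then show "b \<in> range pfaffian_form" by blast
  qed
qed

definition of_rat_vec :: "rat ^ 'n::finite \<Rightarrow> complex ^ 'n" where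
  "of_rat_vec x = (\<chi> i. of_rat (x $ i))"

text \<open>
  A parametrisation of a rational subspace by a linear map that is defined over the rationals also
  parametrises the complexification. The set I selects coordinates that are kept equal to zero.
\<close>

lemma complexify_image:
  fixes f :: "rat ^ 'm::finite \<Rightarrow> rat ^ 'n::finite" and g :: "complex ^ 'm \<Rightarrow> complex ^ 'n"
  assumes g: "Vector_Spaces.linear (*s) (*s) g" and fg: "\<And>x. of_rat_vec (f x) = g (of_rat_vec x)"
  shows "complexify (f ` {x. \<forall>i\<in>I. x $ i = 0}) = g ` {x. \<forall>i\<in>I. x $ i = 0}"
proof
  have cplx: "complexify U = vec.span (of_rat_vec ` U)" for U :: "(rat ^ 'n) set"
    unfolding complexify_def of_rat_vec_def by simp
  have sub: "vec.subspace (g ` {x. \<forall>i\<in>I. x $ i = 0})"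
    by (rule vec.linear_subspace_image[OF g]) (auto simp: vec.subspace_def)
  show "complexify (f ` {x. \<forall>i\<in>I. x $ i = 0}) \<subseteq> g ` {x. \<forall>i\<in>I. x $ i = 0}"
    unfolding cplx
  proof (rule vec.span_minimal[OF _ sub], rule image_subsetI)
    fix y assume "y \<in> f ` {x. \<forall>i\<in>I. x $ i = 0}"
    then obtain x where x: "y = f x" "\<forall>i\<in>I. x $ i = 0" by blast
    then show "of_rat_vec y \<in> g ` {x. \<forall>i\<in>I. x $ i = 0}"
      using fg by (intro image_eqI[of _ _ "of_rat_vec x"]) (auto simp: of_rat_vec_def)
  qed
  show "g ` {x. \<forall>i\<in>I. x $ i = 0} \<subseteq> complexify (f ` {x. \<forall>i\<in>I. x $ i = 0})"
  proof
    fix y assume "y \<in> g ` {x. \<forall>i\<in>I. x $ i = 0}"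
    then obtain x where x: "y = g x" "\<forall>i\<in>I. x $ i = 0" by blast
    have "y = g (\<Sum>i\<in>UNIV. x $ i *s axis i 1)" using x by (simp add: basis_expansion)
    also have "\<dots> = (\<Sum>i\<in>UNIV. x $ i *s g (axis i 1))"
      by (simp add: vec.linear_sum[OF g] vec.linear_scale[OF g])
    also have "\<dots> \<in> complexify (f ` {x. \<forall>i\<in>I. x $ i = 0})"
      unfolding cplx
    proof (rule vec.span_sum)
      fix i
      show "x $ i *s g (axis i 1) \<in> vec.span (of_rat_vec ` f ` {x. \<forall>i\<in>I. x $ i = 0})"
      proof (cases "i \<in> I")
        case True
        then show ?thesis using x by (simp add: vec.span_zero)
      next
        case False
        have "of_rat_vec (axis i 1) = axis i 1" by (simp add: of_rat_vec_def axis_component vec_eq_iff)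
        then have "g (axis i 1) = of_rat_vec (f (axis i 1))" by (simp add: fg)
        moreover have "axis i 1 \<in> {x::rat^'m. \<forall>i\<in>I. x $ i = 0}" using False by (auto simp: axis_component)
        ultimately have "g (axis i 1) \<in> of_rat_vec ` f ` {x. \<forall>i\<in>I. x $ i = 0}" by blast
        then show ?thesis by (intro vec.span_scale vec.span_base)
      qed
    qed
    finally show "y \<in> complexify (f ` {x. \<forall>i\<in>I. x $ i = 0})" .
  qed
qed

lemma of_rat_elementary: "of_rat_vec (elementary i j) = elementary i j"
  by (simp add: of_rat_vec_def vec_eq_iff elementary_nth of_rat_diff axis_component)

lemma of_rat_vec_linear:
  "of_rat_vec (x + y) = of_rat_vec x + of_rat_vec y" "of_rat_vec (x - y) = of_rat_vec x - of_rat_vec y"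
  "of_rat_vec (c *s x) = of_rat c *s of_rat_vec x"
  by (simp_all add: of_rat_vec_def vec_eq_iff of_rat_add of_rat_diff of_rat_mult)

lemma of_rat_pfaffian_form: "of_rat_vec (pfaffian_form x) = pfaffian_form (of_rat_vec x)"
  unfolding pfaffian_form_def of_rat_vec_linear of_rat_elementary by (simp add: of_rat_vec_def)

lemma of_rat_dual_bivector: "of_rat_vec (dual_bivector x) = dual_bivector (of_rat_vec x)"
  unfolding dual_bivector_def of_rat_vec_linear of_rat_elementary by (simp add: of_rat_vec_def)

lemma dim_coordinate_hyperplane: "vec.dim {x::'a::field ^ 6. x $ 5 = 0} = 5"
proof -
  let ?H = "{x::'a ^ 6. x $ 5 = 0}"
  have "vec.dim (UNIV::('a^6) set) \<le> vec.dim ?H + 1"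
    using dim_kernel_ge[of UNIV "\<lambda>x::'a^6. x $ 5"] by (simp del: vec.dim_UNIV)
  then have "5 \<le> vec.dim ?H" by (simp add: vec_dim_card del: vec.dim_UNIV)
  moreover have "vec.dim ?H \<noteq> 6"
  proof
    assume "vec.dim ?H = 6"
    moreover have "vec.subspace ?H" by (auto simp: vec.subspace_def)
    ultimately have "?H = UNIV"
      by (intro vec.subspace_dim_equal) (auto simp: vec_dim_card simp del: vec.dim_UNIV)
    then have "axis 5 1 \<in> ?H" by blast
    then show False by simp
  qed
  moreover have "vec.dim ?H \<le> 6" using vec.dim_subset[of ?H UNIV] by (simp add: vec_dim_card del: vec.dim_UNIV)
  ultimately show ?thesis by linarith
qed

section \<open>The cubic threefold and the cubic fourfold\<close>

definition form_space :: "'a::field_char_0 array6 set" where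
  "form_space = range pfaffian_form"

definition form_hyperplane :: "'a::field_char_0 array6 set" where
  "form_hyperplane = pfaffian_form ` {x. x $ 5 = 0}"

lemma complexify_form_space: "complexify form_space = form_space"
  using complexify_image[OF linear_pfaffian_form of_rat_pfaffian_form, of "{}"]
  by (simp add: form_space_def)

lemma complexify_form_hyperplane: "complexify form_hyperplane = form_hyperplane"
  using complexify_image[OF linear_pfaffian_form of_rat_pfaffian_form, of "{5}"]
  by (simp add: form_hyperplane_def)

lemma dim_pfaffian_form_image: "vec.dim (pfaffian_form ` S) = vec.dim S"
  by (rule vec.dim_image_eq[OF linear_pfaffian_form]) (rule inj_on_subset[OF inj_pfaffian_form subset_UNIV])

lemma dim_form_space: "vec.dim form_space = 6"
  by (simp add: form_space_def dim_pfaffian_form_image vec_dim_card del: vec.dim_UNIV)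

lemma dim_form_hyperplane: "vec.dim form_hyperplane = 5"
  by (simp add: form_hyperplane_def dim_pfaffian_form_image dim_coordinate_hyperplane)

lemma subspace_form_space: "vec.subspace form_space"
  unfolding form_space_def by (rule vec.linear_subspace_image[OF linear_pfaffian_form]) simp

lemma subspace_form_hyperplane: "vec.subspace form_hyperplane"
  unfolding form_hyperplane_def
  by (rule vec.linear_subspace_image[OF linear_pfaffian_form]) (auto simp: vec.subspace_def)

lemma pfaffian_flag_forms: "pfaffian_flag form_hyperplane form_space"
  unfolding pfaffian_flag_def
  using subspace_form_space subspace_form_hyperplane dim_form_space dim_form_hyperplane
  by (auto simp: form_space_def form_hyperplane_def)

lemma pfaffian_form_add: "pfaffian_form (x + y) = pfaffian_form x + pfaffian_form y"
  and pfaffian_form_scale: "pfaffian_form (c *s x) = c *s pfaffian_form x"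
  using vec.linear_add[OF linear_pfaffian_form] vec.linear_scale[OF linear_pfaffian_form] by auto

lemma cyclic_triple_cover_forms: "cyclic_triple_cover form_hyperplane form_space"
proof -
  \<comment> \<open>the factors -1 below account for the sign in pf_pfaffian_form\<close>
  define w :: "rat array6" where "w = pfaffian_form (axis 5 1)"
  have w: "w \<notin> form_hyperplane"
  proof
    assume "w \<in> form_hyperplane"
    then obtain x :: "rat ^ 6" where "pfaffian_form (axis 5 1) = pfaffian_form x" "x $ 5 = 0"
      by (auto simp: w_def form_hyperplane_def)
    then have "axis 5 1 = x" using inj_pfaffian_form by (auto dest: injD)
    then show False using \<open>x $ 5 = 0\<close> by (auto simp: axis_component)
  qed
  have "form_space = vec.span (insert w form_hyperplane)"
  proof
    show "form_space \<subseteq> vec.span (insert w form_hyperplane)"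
    proof
      fix z :: "rat array6" assume "z \<in> form_space"
      then obtain x where z: "z = pfaffian_form x" by (auto simp: form_space_def)
      have "x = (x - x $ 5 *s axis 5 1) + x $ 5 *s axis 5 1" by simp
      then have "z = pfaffian_form (x - x $ 5 *s axis 5 1) + x $ 5 *s w"
        unfolding z w_def pfaffian_form_add[symmetric] pfaffian_form_scale[symmetric] by simp
      moreover have "pfaffian_form (x - x $ 5 *s axis 5 1) \<in> form_hyperplane"
        by (auto simp: form_hyperplane_def axis_component)
      ultimately show "z \<in> vec.span (insert w form_hyperplane)"
        by (auto intro: vec.span_add vec.span_scale vec.span_base)
    qed
    have "w \<in> form_space" "(form_hyperplane :: rat array6 set) \<subseteq> form_space"
      by (auto simp: w_def form_space_def form_hyperplane_def)
    then show "vec.span (insert w form_hyperplane) \<subseteq> form_space"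
      by (intro vec.span_minimal subspace_form_space) auto
  qed
  moreover have "-1 * pf (z + t *s w) = -1 * pf z + t ^ 3" if z: "z \<in> form_hyperplane" for z t
  proof -
    obtain x where x: "z = pfaffian_form x" "x $ 5 = 0" using z by (auto simp: form_hyperplane_def)
    have "z + t *s w = pfaffian_form (x + t *s axis 5 1)"
      by (simp add: x w_def pfaffian_form_add pfaffian_form_scale)
    then show ?thesis
      by (simp add: x pf_pfaffian_form fourfold_def cubic_def axis_component)
  qed
  ultimately show ?thesis
    unfolding cyclic_triple_cover_def using w
    by (intro exI[of _ w] exI[of _ "-1"] conjI ballI allI) (assumption | simp only: neg_equal_0_iff_equal one_neq_zero not_False_eq_True)+
qed

lemma polyfun_uminus: "F \<in> polyfun \<Longrightarrow> (\<lambda>x. - F x) \<in> polyfun"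
  using polyfun.mult[OF polyfun.const[of "-1"]] by simp

lemma polyfun_diff: "F \<in> polyfun \<Longrightarrow> G \<in> polyfun \<Longrightarrow> (\<lambda>x. F x - G x) \<in> polyfun"
  using polyfun.add[OF _ polyfun_uminus] by simp

lemmas polyfun_intros = polyfun.intros polyfun_uminus polyfun_diff

lemma polyfun_pf4: "(\<lambda>a. pf4 a i j k l) \<in> polyfun"
  unfolding pf4_def by (intro polyfun_intros)

lemma polyfun_pf: "pf \<in> polyfun"
proof -
  have "(\<lambda>a. pf a) \<in> polyfun"
    unfolding pf_def by (intro polyfun_intros polyfun_pf4)
  then show ?thesis by simp
qed

lemma in_ideal_on: "F \<in> E \<Longrightarrow> F \<in> ideal_on L E"
  unfolding ideal_on_def
  by (intro CollectI exI[of _ "{F}"] exI[of _ "\<lambda>_ _. 1"]) (auto intro: polyfun.const)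

lemma in_local_ideal: "F \<in> E \<Longrightarrow> F \<in> polyfun \<Longrightarrow> F \<in> local_ideal L E p"
  unfolding local_ideal_def
  by (intro CollectI conjI bexI[of _ "\<lambda>_. 1"]) (auto intro: in_ideal_on polyfun.const)

lemma smooth_hypersurface:
  assumes F: "F \<in> polyfun" and dim: "vec.dim L = d + 2"
    and grad: "\<And>p. p \<in> L \<Longrightarrow> F p = 0 \<Longrightarrow> p \<noteq> 0 \<Longrightarrow> \<exists>v\<in>L. differential F p v \<noteq> 0"
  shows "smooth_of_dim (L, {F}) d"
  unfolding smooth_of_dim_def prod.case
proof (intro ballI impI)
  fix p assume "p \<in> cone (L, {F})" "p \<noteq> 0"
  then obtain v where v: "v \<in> L" "differential F p v \<noteq> 0"
    using grad[of p] by (auto simp: cone_def)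
  then have "independent_differentials L {F} p"
    by (auto simp: independent_differentials_def)
  then show "\<exists>G. finite G \<and> card G + (d + 1) = vec.dim L \<and> G \<subseteq> local_ideal L {F} p \<and>
      {F} \<subseteq> local_ideal L G p \<and> independent_differentials L G p"
    using F dim by (intro exI[of _ "{F}"]) (auto intro: in_local_ideal)
qed

lemma differential_pf:
  "differential pf (pfaffian_form x) (pfaffian_form y) = - (cubic_polar x y + 3 * (x$5)\<^sup>2 * y$5)"
proof -
  have eq: "pf (pfaffian_form x + t *s pfaffian_form y) = - (cubic x + t * cubic_polar x y
      + t\<^sup>2 * cubic_polar y x + t^3 * cubic y + (x$5 + t * y$5)^3)" for t
    unfolding pfaffian_form_scale[symmetric] pfaffian_form_add[symmetric] pf_pfaffian_form
      fourfold_def cubic_expand by simp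
  have "((\<lambda>t. pf (pfaffian_form x + t *s pfaffian_form y)) has_field_derivative
      - (cubic_polar x y + 3 * (x$5)\<^sup>2 * y$5)) (at 0)"
    unfolding eq by (auto intro!: derivative_eq_intros simp: power2_eq_square)
  then show ?thesis
    unfolding differential_def by (rule DERIV_imp_deriv)
qed

text \<open>
  The derivative along the direction of the triple cover is \<open>3 t^2\<close>, so a singular point of the cover
  lies over a singular point of the threefold.
\<close>

theorem fourfold_smooth:
  fixes x :: "complex ^ 6"
  assumes "fourfold x = 0" and grad: "\<And>y. cubic_polar x y + 3 * (x$5)\<^sup>2 * y$5 = 0"
  shows "x = 0"
proof -
  have x5: "x $ 5 = 0"
    using grad[of "axis 5 1"] by (simp add: cubic_polar_def axis_component)
  then have "x$0 = 0 \<and> x$1 = 0 \<and> x$2 = 0 \<and> x$3 = 0 \<and> x$4 = 0"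
    using assms by (intro cubic_smooth) (auto simp: fourfold_def)
  then show ?thesis using x5 by (simp add: vec_eq_iff all_6)
qed

lemma fourfold_gradient:
  fixes \<omega> :: "complex array6"
  assumes "\<omega> \<in> form_space" "pf \<omega> = 0" "\<omega> \<noteq> 0"
  shows "\<exists>\<eta>\<in>form_space. differential pf \<omega> \<eta> \<noteq> 0"
proof -
  obtain x where x: "\<omega> = pfaffian_form x" using assms by (auto simp: form_space_def)
  have "\<exists>y. cubic_polar x y + 3 * (x$5)\<^sup>2 * y$5 \<noteq> 0"
    using fourfold_smooth[of x] assms x pf_pfaffian_form[of x] vec.linear_0[OF linear_pfaffian_form] by auto
  then obtain y where "cubic_polar x y + 3 * (x$5)\<^sup>2 * y$5 \<noteq> 0" by blast
  then have "differential pf \<omega> (pfaffian_form y) \<noteq> 0"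
    unfolding x differential_pf by (simp only: neg_equal_0_iff_equal not_False_eq_True)
  then show ?thesis by (auto simp: form_space_def)
qed

lemma smooth_fourfold: "smooth_of_dim (pfaffian_cubic form_space) 4"
  unfolding pfaffian_cubic_def complexify_form_space
  by (rule smooth_hypersurface[OF polyfun_pf]) (simp_all add: dim_form_space fourfold_gradient)

lemma smooth_threefold: "smooth_of_dim (pfaffian_cubic form_hyperplane) 3"
  unfolding pfaffian_cubic_def complexify_form_hyperplane
proof (rule smooth_hypersurface[OF polyfun_pf])
  fix p :: "complex array6" assume p: "p \<in> form_hyperplane" "pf p = 0" "p \<noteq> 0"
  then obtain x where x: "p = pfaffian_form x" "x $ 5 = 0" by (auto simp: form_hyperplane_def)
  have "\<exists>y. cubic_polar x y \<noteq> 0"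
    using fourfold_smooth[of x] p x pf_pfaffian_form[of x] vec.linear_0[OF linear_pfaffian_form] by auto
  then obtain y where y: "cubic_polar x y \<noteq> 0" by blast
  \<comment> \<open>project the direction to the hyperplane of the threefold\<close>
  define y' where "y' = y - y $ 5 *s axis 5 1"
  have "y' $ 5 = 0" "cubic_polar x y' = cubic_polar x y"
    by (simp_all add: y'_def cubic_polar_def axis_component)
  then have "differential pf p (pfaffian_form y') \<noteq> 0" "pfaffian_form y' \<in> form_hyperplane"
    unfolding x differential_pf using y x by (auto simp: form_hyperplane_def)
  then show "\<exists>v\<in>form_hyperplane. differential pf p v \<noteq> 0" by blast
qed (simp add: dim_form_hyperplane)

lemma fourfold_linear_subspace:
  assumes M: "vec.subspace M" "M \<subseteq> form_space" and pf: "\<And>\<omega>. \<omega> \<in> M \<Longrightarrow> pf \<omega> = (0::complex)"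
  shows "vec.dim M \<le> 2"
proof (rule ccontr)
  assume large: "\<not> vec.dim M \<le> 2"
  define N where "N = {x. pfaffian_form x \<in> M}"
  have "pfaffian_form ` N = M" using M by (auto simp: N_def form_space_def)
  then have "vec.dim N = vec.dim M" using dim_pfaffian_form_image by metis
  moreover have "vec.subspace N"
    using vec.linear_subspace_vimage[OF linear_pfaffian_form M(1)] by (simp add: N_def vimage_def)
  moreover have "fourfold x = 0" if "x \<in> N" for x
    using pf[of "pfaffian_form x"] that by (simp add: N_def pf_pfaffian_form)
  ultimately show False using fourfold_no_plane[of N] large by simp
qed

lemma no_plane_fourfold: "\<not> contains_plane (pfaffian_cubic form_space)"
proof
  assume "contains_plane (pfaffian_cubic form_space)"
  then obtain M :: "complex array6 set" where M: "vec.subspace M" "vec.dim M = 3" "M \<subseteq> {\<omega> \<in> form_space. pf \<omega> = 0}"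
    by (auto simp: contains_linear_space_def pfaffian_cubic_def complexify_form_space cone_def)
  then have "vec.dim M \<le> 2" by (intro fourfold_linear_subspace) auto
  then show False using M by simp
qed

section \<open>Smoothness of the K3 surface\<close>

definition contract :: "'a::field_char_0 ^ 6 \<Rightarrow> 'a array6 \<Rightarrow> 'a ^ 6" where
  "contract u a = (\<chi> j. \<Sum>i\<in>UNIV. u $ i * a $ (i, j))"

text \<open>
  The bilinear form attached to the quadratic form \<open>pf4\<close>.
\<close>

definition pf4_polar :: "'a::field_char_0 array6 \<Rightarrow> 'a array6 \<Rightarrow> 6 \<Rightarrow> 6 \<Rightarrow> 6 \<Rightarrow> 6 \<Rightarrow> 'a" where
  "pf4_polar a b i j k l = a$(i,j) * b$(k,l) + b$(i,j) * a$(k,l) - a$(i,k) * b$(j,l) - b$(i,k) * a$(j,l)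
    + a$(i,l) * b$(j,k) + b$(i,l) * a$(j,k)"

lemma skew_lower:
  assumes "a \<in> skew"
  shows "a$(1,0) = - a$(0,1)" "a$(2,0) = - a$(0,2)" "a$(3,0) = - a$(0,3)" "a$(4,0) = - a$(0,4)"
    "a$(5,0) = - a$(0,5)" "a$(2,1) = - a$(1,2)" "a$(3,1) = - a$(1,3)" "a$(4,1) = - a$(1,4)"
    "a$(5,1) = - a$(1,5)" "a$(3,2) = - a$(2,3)" "a$(4,2) = - a$(2,4)" "a$(5,2) = - a$(2,5)"
    "a$(4,3) = - a$(3,4)" "a$(5,3) = - a$(3,5)" "a$(5,4) = - a$(4,5)" "a$(i,i) = 0"
  using assms by (auto intro: skewD skew_diag)

text \<open>
  For vectors u, v and a form a, the product of \<open>(u \<and> v)\<^sub>k\<^sub>l\<close> and the Pfaffian of a is governed by the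
  complementary block m, n, r, s: it is \<open>a(u, v)\<close> times the Pfaffian of that block, up to a term
  bilinear in the contractions of a with u and v. In the instances below e is the sign of the
  permutation k, l, m, n, r, s.
\<close>

definition wedge_pf_identity :: "6 \<Rightarrow> 6 \<Rightarrow> 6 \<Rightarrow> 6 \<Rightarrow> 6 \<Rightarrow> 6 \<Rightarrow> complex \<Rightarrow> bool" where
  "wedge_pf_identity k l m n r s e \<longleftrightarrow> (\<forall>a u v. a \<in> skew \<longrightarrow> wedge u v $ (k, l) * pf a =
     e * ((\<Sum>j\<in>UNIV. contract u a $ j * v $ j) * pf4 a m n r s - pf4_polar a (wedge (contract u a) (contract v a)) m n r s))"

lemma wedge_pf_identities:
  "wedge_pf_identity 0 1 2 3 4 5 1" "wedge_pf_identity 0 2 1 3 4 5 (-1)" "wedge_pf_identity 0 3 1 2 4 5 1"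
  "wedge_pf_identity 0 4 1 2 3 5 (-1)" "wedge_pf_identity 0 5 1 2 3 4 1" "wedge_pf_identity 1 2 0 3 4 5 1"
  "wedge_pf_identity 1 3 0 2 4 5 (-1)" "wedge_pf_identity 1 4 0 2 3 5 1" "wedge_pf_identity 1 5 0 2 3 4 (-1)"
  "wedge_pf_identity 2 3 0 1 4 5 1" "wedge_pf_identity 2 4 0 1 3 5 (-1)" "wedge_pf_identity 2 5 0 1 3 4 1"
  "wedge_pf_identity 3 4 0 1 2 5 1" "wedge_pf_identity 3 5 0 1 2 4 (-1)" "wedge_pf_identity 4 5 0 1 2 3 1"
  unfolding wedge_pf_identity_def
  by (intro allI impI, simp only: pf_def pf4_def pf4_polar_def wedge_def contract_def vec_lambda_beta
      fst_conv snd_conv sum_6 skew_lower, algebra)+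

lemma ex_wedge_pf_identity:
  assumes "k \<noteq> l"
  shows "\<exists>m n r s e. wedge_pf_identity k l m n r s e"
proof -
  have swap: "wedge_pf_identity l k m n r s (- e)" if "wedge_pf_identity k l m n r s e" for k l m n r s e
  proof -
    have "wedge u v $ (l, k) = - wedge u v $ (k, l)" for u v :: "complex ^ 6"
      by (simp add: wedge_def)
    then show ?thesis using that unfolding wedge_pf_identity_def by simp
  qed
  have "\<forall>k l. k \<noteq> l \<longrightarrow> (\<exists>m n r s e. wedge_pf_identity k l m n r s e)"
    unfolding all_6 using wedge_pf_identities wedge_pf_identities[THEN swap] by blast
  then show ?thesis using assms by blast
qed

lemma contract_linear: "contract u (a + t *s b) = contract u a + t *s contract u b"
  by (simp add: contract_def vec_eq_iff algebra_simps sum.distrib sum_distrib_left)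

text \<open>
  The Pfaffian has a double zero at \<open>\<omega>\<close> along \<open>\<omega> + t \<eta>\<close> when u and v span a plane in the kernel of \<open>\<omega>\<close>
  that is isotropic for \<open>\<eta>\<close>: the contractions of \<open>\<omega> + t \<eta>\<close> with u and v are divisible by t and its
  value on u, v is zero, so every term of the identity above is divisible by \<open>t^2\<close>.
\<close>

lemma differential_pf_zero:
  fixes \<omega> \<eta> :: "complex array6"
  assumes skew: "\<omega> \<in> skew" "\<eta> \<in> skew" and uv: "wedge u v \<noteq> 0"
    and kernel: "contract u \<omega> = 0" "contract v \<omega> = 0" and \<eta>: "(\<Sum>j\<in>UNIV. contract u \<eta> $ j * v $ j) = 0"
  shows "differential pf \<omega> \<eta> = 0"
proof -
  obtain k l where kl: "wedge u v $ (k, l) \<noteq> 0" using uv by (auto simp: vec_eq_iff)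
  then have "k \<noteq> l" by (auto simp: wedge_def)
  then obtain m n r s e where c: "wedge_pf_identity k l m n r s e" using ex_wedge_pf_identity by blast
  define N where "N = wedge (contract u \<eta>) (contract v \<eta>)"
  define A where "A = - e * pf4_polar \<omega> N m n r s / wedge u v $ (k, l)"
  define B where "B = - e * pf4_polar \<eta> N m n r s / wedge u v $ (k, l)"
  have "pf (\<omega> + t *s \<eta>) = t\<^sup>2 * (A + t * B)" for t
  proof -
    have "\<omega> + t *s \<eta> \<in> skew"
      using skew subspace_skew by (intro vec.subspace_add vec.subspace_scale)
    moreover have "contract u (\<omega> + t *s \<eta>) = t *s contract u \<eta>" "contract v (\<omega> + t *s \<eta>) = t *s contract v \<eta>"
      by (simp_all add: contract_linear kernel)
    moreover have "(\<Sum>j\<in>UNIV. (t *s contract u \<eta>) $ j * v $ j) = 0"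
      using \<eta> by (simp add: mult.assoc sum_distrib_left[symmetric])
    ultimately have "wedge u v $ (k, l) * pf (\<omega> + t *s \<eta>)
        = - e * pf4_polar (\<omega> + t *s \<eta>) (wedge (t *s contract u \<eta>) (t *s contract v \<eta>)) m n r s"
      using c unfolding wedge_pf_identity_def by simp
    also have "wedge (t *s contract u \<eta>) (t *s contract v \<eta>) = t\<^sup>2 *s N"
      by (simp add: N_def wedge_def vec_eq_iff power2_eq_square algebra_simps)
    also have "- e * pf4_polar (\<omega> + t *s \<eta>) (t\<^sup>2 *s N) m n r s
        = t\<^sup>2 * (- e * pf4_polar \<omega> N m n r s + t * (- e * pf4_polar \<eta> N m n r s))"
      by (simp add: pf4_polar_def algebra_simps)
    finally show ?thesis
      using kl unfolding A_def B_def by (simp add: field_simps)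
  qed
  then have "differential pf \<omega> \<eta> = deriv (\<lambda>t. t\<^sup>2 * (A + t * B)) 0"
    by (simp add: differential_def)
  also have "\<dots> = 0"
    by (rule DERIV_imp_deriv) (auto intro!: derivative_eq_intros)
  finally show ?thesis .
qed

lemma form_space_skew: "\<omega> \<in> form_space \<Longrightarrow> \<omega> \<in> skew"
  by (auto simp: form_space_def)

lemma sum_pairs:
  "(\<Sum>p\<in>UNIV. g p) = (\<Sum>i\<in>UNIV. \<Sum>j\<in>UNIV. g (i, j))" for g :: "6 \<times> 6 \<Rightarrow> 'a::comm_monoid_add"
  unfolding UNIV_Times_UNIV[symmetric] by (simp add: sum.cartesian_product)

lemma pairing_wedge:
  assumes "a \<in> skew"
  shows "(\<Sum>p\<in>UNIV. a $ p * wedge u y $ p) = 2 * (\<Sum>j\<in>UNIV. contract u a $ j * y $ j)"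
proof -
  have "(\<Sum>p\<in>UNIV. a $ p * wedge u y $ p)
      = (\<Sum>i\<in>UNIV. \<Sum>j\<in>UNIV. a $ (i, j) * (u $ i * y $ j)) - (\<Sum>i\<in>UNIV. \<Sum>j\<in>UNIV. a $ (i, j) * (u $ j * y $ i))"
    unfolding sum_pairs by (simp add: wedge_def right_diff_distrib sum_subtractf)
  also have "(\<Sum>i\<in>UNIV. \<Sum>j\<in>UNIV. a $ (i, j) * (u $ j * y $ i))
      = (\<Sum>j\<in>UNIV. \<Sum>i\<in>UNIV. - (a $ (j, i) * (u $ j * y $ i)))"
  proof (subst sum.swap, intro sum.cong refl)
    fix i j show "a $ (j, i) * (u $ i * y $ j) = - (a $ (i, j) * (u $ i * y $ j))"
      using skewD[OF assms, of j i] by simp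
  qed
  also have "\<dots> = - (\<Sum>i\<in>UNIV. \<Sum>j\<in>UNIV. a $ (i, j) * (u $ i * y $ j))"
    by (simp add: sum_negf)
  also have "(\<Sum>i\<in>UNIV. \<Sum>j\<in>UNIV. a $ (i, j) * (u $ i * y $ j)) = (\<Sum>j\<in>UNIV. contract u a $ j * y $ j)"
    by (subst sum.swap) (simp add: contract_def sum_distrib_left sum_distrib_right mult_ac)
  finally show ?thesis by simp
qed

text \<open>
  A nonzero form of the system whose kernel contains a point \<open>u \<and> v\<close> of the K3 surface would be a
  singular point of the fourfold, since its Pfaffian has vanishing derivative along every form of the
  system.
\<close>

theorem no_kernel_plane:
  fixes \<omega> :: "complex array6"
  assumes \<omega>: "\<omega> \<in> form_space" and uv: "wedge u v \<noteq> 0" "wedge u v \<in> annihilator form_space"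
    and kernel: "contract u \<omega> = 0" "contract v \<omega> = 0"
  shows "\<omega> = 0"
proof (rule ccontr)
  assume "\<omega> \<noteq> 0"
  have "wedge 0 v = 0" by (simp add: wedge_def vec_eq_iff)
  then have "u \<noteq> 0" using uv(1) by auto
  then have "degenerate \<omega>"
    using kernel(1) unfolding degenerate_def contract_def vec_eq_iff vec_lambda_beta zero_index by blast
  then have "pf \<omega> = 0" using degenerate_iff_pf form_space_skew \<omega> by blast
  then obtain \<eta> where \<eta>: "\<eta> \<in> form_space" "differential pf \<omega> \<eta> \<noteq> 0"
    using fourfold_gradient \<omega> \<open>\<omega> \<noteq> 0\<close> by blast
  have "(\<Sum>p\<in>UNIV. \<eta> $ p * wedge u v $ p) = 0" using uv \<eta> by (auto simp: annihilator_def)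
  then have "(\<Sum>j\<in>UNIV. contract u \<eta> $ j * v $ j) = 0"
    using \<eta> by (simp add: pairing_wedge form_space_skew)
  then show False using differential_pf_zero \<omega> \<eta> uv kernel form_space_skew by blast
qed

lemma annihilator_form_space: "annihilator form_space = range dual_bivector"
  by (simp add: form_space_def annihilator_pfaffian_form)

lemma complexify_annihilator: "complexify (annihilator form_space) = annihilator form_space"
  using complexify_image[OF linear_dual_bivector of_rat_dual_bivector, of "{}"]
  by (simp add: annihilator_form_space)

lemma dim_annihilator: "vec.dim (annihilator form_space :: complex array6 set) = 9"
proof -
  have "vec.dim (range (dual_bivector :: complex ^ 9 \<Rightarrow> _)) = vec.dim (UNIV :: (complex ^ 9) set)"
    by (rule vec.dim_image_eq[OF linear_dual_bivector]) (rule inj_on_subset[OF inj_dual_bivector subset_UNIV])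
  then show ?thesis by (simp add: annihilator_form_space vec_dim_card del: vec.dim_UNIV)
qed

lemma form_orthogonal_to_annihilator:
  assumes "\<omega> \<in> skew" "\<And>b. b \<in> annihilator form_space \<Longrightarrow> (\<Sum>p\<in>UNIV. \<omega> $ p * b $ p) = 0"
  shows "\<omega> \<in> form_space"
proof -
  have "(\<Sum>p\<in>UNIV. b $ p * \<omega> $ p) = 0" if "b \<in> range dual_bivector" for b
    using assms(2)[of b] that by (simp add: annihilator_form_space mult.commute)
  then have "\<omega> \<in> annihilator (range dual_bivector)"
    using assms(1) by (auto simp: annihilator_def)
  then show ?thesis by (simp add: annihilator_dual_bivector form_space_def)
qed

lemma ideal_on_cong: "F \<in> ideal_on L G \<Longrightarrow> (\<And>x. x \<in> L \<Longrightarrow> F' x = F x) \<Longrightarrow> F' \<in> ideal_on L G"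
  unfolding ideal_on_def by fastforce

lemma ideal_on_zero: "(\<And>x. x \<in> L \<Longrightarrow> F x = 0) \<Longrightarrow> F \<in> ideal_on L G"
  unfolding ideal_on_def by (auto intro!: exI[of _ "{}"])

lemma ideal_on_mult:
  assumes "F \<in> ideal_on L G" "h \<in> polyfun"
  shows "(\<lambda>x. h x * F x) \<in> ideal_on L G"
proof -
  obtain A c where "finite A" "A \<subseteq> G" "c ` A \<subseteq> polyfun" "\<forall>x\<in>L. F x = (\<Sum>g\<in>A. c g x * g x)"
    using assms(1) unfolding ideal_on_def by blast
  then show ?thesis
    unfolding ideal_on_def using assms(2)
    by (intro CollectI exI[of _ A] exI[of _ "\<lambda>g x. h x * c g x"])
      (auto simp: sum_distrib_left mult.assoc intro!: polyfun.mult)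
qed

lemma ideal_on_add:
  assumes "F \<in> ideal_on L G" "F' \<in> ideal_on L G"
  shows "(\<lambda>x. F x + F' x) \<in> ideal_on L G"
proof -
  obtain A c where A: "finite A" "A \<subseteq> G" "c ` A \<subseteq> polyfun" "\<forall>x\<in>L. F x = (\<Sum>g\<in>A. c g x * g x)"
    using assms(1) unfolding ideal_on_def by blast
  obtain A' c' where A': "finite A'" "A' \<subseteq> G" "c' ` A' \<subseteq> polyfun" "\<forall>x\<in>L. F' x = (\<Sum>g\<in>A'. c' g x * g x)"
    using assms(2) unfolding ideal_on_def by blast
  define d where "d g = (\<lambda>x. (if g \<in> A then c g x else 0) + (if g \<in> A' then c' g x else 0))" for g
  have "d g \<in> polyfun" for g
  proof -
    have "(\<lambda>x. if g \<in> A then c g x else 0) \<in> polyfun" "(\<lambda>x. if g \<in> A' then c' g x else 0) \<in> polyfun"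
      using A A' polyfun.const[of 0] by (cases "g \<in> A"; cases "g \<in> A'"; auto)+
    then show ?thesis unfolding d_def by (rule polyfun.add)
  qed
  moreover have "F x + F' x = (\<Sum>g\<in>A \<union> A'. d g x * g x)" if "x \<in> L" for x
  proof -
    have "(\<Sum>g\<in>A \<union> A'. d g x * g x) = (\<Sum>g\<in>A \<union> A'. if g \<in> A then c g x * g x else 0)
        + (\<Sum>g\<in>A \<union> A'. if g \<in> A' then c' g x * g x else 0)"
      unfolding sum.distrib[symmetric] by (rule sum.cong) (auto simp: d_def algebra_simps)
    also have "\<dots> = (\<Sum>g\<in>A. c g x * g x) + (\<Sum>g\<in>A'. c' g x * g x)"
      using A A' by (simp add: sum.If_cases Int_absorb1 Int_absorb2 Un_Int_distrib2)
    finally show ?thesis using A A' that by simp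
  qed
  ultimately show ?thesis
    unfolding ideal_on_def using A A' by (intro CollectI exI[of _ "A \<union> A'"] exI[of _ d]) auto
qed


lemma pf4_swap_last: "x \<in> skew \<Longrightarrow> pf4 x i j l k = - pf4 x i j k l"
  using skewD[of x k l] by (simp add: pf4_def)

text \<open>
  Where the Pluecker coordinate i, j is nonzero, the quadrics \<open>pf4 i j k l\<close> generate the others: modulo
  them \<open>b\<^sub>i\<^sub>j b\<^sub>k\<^sub>l\<close> equals \<open>D k l = b\<^sub>i\<^sub>k b\<^sub>j\<^sub>l - b\<^sub>i\<^sub>l b\<^sub>j\<^sub>k\<close>, and the D are the coordinates of a decomposable
  bivector, hence satisfy all Pluecker relations.
\<close>

lemma pluecker_chart:
  assumes L: "L \<subseteq> skew"
    and P: "\<And>k l. k \<notin> {i, j} \<Longrightarrow> l \<notin> {i, j} \<Longrightarrow> k \<noteq> l \<Longrightarrow> (k, l) \<in> P \<or> (l, k) \<in> P"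
    and G: "G = (\<lambda>(k, l) x. pf4 x i j k l) ` P"
    and p: "p $ (i, j) \<noteq> 0"
  shows "pluecker_quadrics \<subseteq> local_ideal L G p"
proof
  fix F :: "complex array6 \<Rightarrow> complex" assume "F \<in> pluecker_quadrics"
  then obtain k l m n where F: "F = (\<lambda>x. pf4 x k l m n)" by (auto simp: pluecker_quadrics_def)
  have Q: "(\<lambda>x. pf4 x i j k l) \<in> ideal_on L G" for k l
  proof (cases "k \<in> {i, j} \<or> l \<in> {i, j} \<or> k = l")
    case True
    have "pf4 x i j k l = 0" if "x \<in> L" for x
    proof -
      have x: "x \<in> skew" using that L by blast
      show ?thesis
        using True skewD[OF x, of j i] skewD[OF x, of l i] skewD[OF x, of k j] skewD[OF x, of k i]
          skewD[OF x, of l j] skew_diag[OF x]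
        by (auto simp: pf4_def)
    qed
    then show ?thesis by (rule ideal_on_zero)
  next
    case False
    then consider "(k, l) \<in> P" | "(l, k) \<in> P" using P by blast
    then show ?thesis
    proof cases
      case 1
      then show ?thesis by (intro in_ideal_on) (auto simp: G)
    next
      case 2
      then have "(\<lambda>x. pf4 x i j l k) \<in> ideal_on L G" by (intro in_ideal_on) (auto simp: G)
      then have "(\<lambda>x. -1 * pf4 x i j l k) \<in> ideal_on L G" by (rule ideal_on_mult) (rule polyfun.const)
      then show ?thesis
      proof (rule ideal_on_cong)
        fix x assume "x \<in> L"
        then have "x \<in> skew" using L by blast
        then show "pf4 x i j k l = -1 * pf4 x i j l k" using pf4_swap_last[of x i j k l] by simp
      qed
    qed
  qed
  have multiple: "(\<lambda>x. h x * pf4 x i j k l) \<in> ideal_on L G" if "h \<in> polyfun" for h k l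
    by (rule ideal_on_mult[OF Q that])
  define D where "D k l x = x $ (i, k) * x $ (j, l) - x $ (i, l) * x $ (j, k)" for k l and x :: "complex array6"
  have "(\<lambda>x. ((((x$(i,j) * x$(m,n)) * pf4 x i j k l + D k l x * pf4 x i j m n)
      + (- (x$(i,j) * x$(l,n))) * pf4 x i j k m) + (- D k m x) * pf4 x i j l n
      + (x$(i,j) * x$(l,m)) * pf4 x i j k n) + D k n x * pf4 x i j l m) \<in> ideal_on L G"
    unfolding D_def by (intro ideal_on_add multiple polyfun_intros)
  then have "(\<lambda>x. (x$(i,j))\<^sup>2 * F x) \<in> ideal_on L G"
    by (rule ideal_on_cong) (simp add: F pf4_def D_def power2_eq_square, algebra)
  moreover have "(\<lambda>x. (x$(i,j))\<^sup>2) \<in> polyfun"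
    unfolding power2_eq_square by (intro polyfun_intros)
  ultimately show "F \<in> local_ideal L G p"
    unfolding local_ideal_def F using p polyfun_pf4 by (intro CollectI conjI bexI[of _ "\<lambda>x. (x$(i,j))\<^sup>2"]) auto
qed

lemma contract_axis: "contract (axis k 1) x $ j = x $ (k, j)"
proof -
  have "contract (axis k 1) x $ j = (\<Sum>i\<in>UNIV. if i = k then x $ (k, j) else 0)"
    unfolding contract_def vec_lambda_beta by (rule sum.cong) (auto simp: axis_component)
  then show ?thesis by simp
qed

lemma pairing_elementary:
  assumes "x \<in> skew"
  shows "(\<Sum>q\<in>UNIV. elementary k l $ q * x $ q) = 2 * x $ (k, l)"
proof -
  have "(\<Sum>q\<in>UNIV. elementary k l $ q * x $ q) = (\<Sum>q\<in>UNIV. x $ q * elementary k l $ q)"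
    by (simp add: mult.commute)
  also have "\<dots> = 2 * (\<Sum>j\<in>UNIV. contract (axis k 1) x $ j * axis l 1 $ j)"
    by (rule pairing_wedge[OF assms])
  also have "(\<Sum>j\<in>UNIV. contract (axis k 1) x $ j * axis l 1 $ j) = (\<Sum>j\<in>UNIV. if j = l then x $ (k, l) else 0)"
    by (rule sum.cong) (auto simp: contract_axis axis_component)
  finally show ?thesis by simp
qed

text \<open>
  The differential of \<open>pf4 i j k l\<close> at p, as a form on bivectors.
\<close>

definition quadric_gradient :: "complex array6 \<Rightarrow> 6 \<Rightarrow> 6 \<Rightarrow> 6 \<Rightarrow> 6 \<Rightarrow> complex array6" where
  "quadric_gradient p i j k l = p$(i,j) *s elementary k l + p$(k,l) *s elementary i j
    - p$(i,k) *s elementary j l - p$(j,l) *s elementary i k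
    + p$(i,l) *s elementary j k + p$(j,k) *s elementary i l"

lemma quadric_gradient_skew: "quadric_gradient p i j k l \<in> skew"
  unfolding quadric_gradient_def using subspace_skew skew_elementary
  by (intro vec.subspace_add vec.subspace_diff vec.subspace_scale)

lemma pairing_quadric_gradient:
  assumes "x \<in> skew"
  shows "(\<Sum>q\<in>UNIV. quadric_gradient p i j k l $ q * x $ q) = 2 * pf4_polar p x i j k l"
proof -
  have "(\<Sum>q\<in>UNIV. quadric_gradient p i j k l $ q * x $ q)
      = p$(i,j) * (\<Sum>q\<in>UNIV. elementary k l $ q * x $ q) + p$(k,l) * (\<Sum>q\<in>UNIV. elementary i j $ q * x $ q)
      - p$(i,k) * (\<Sum>q\<in>UNIV. elementary j l $ q * x $ q) - p$(j,l) * (\<Sum>q\<in>UNIV. elementary i k $ q * x $ q)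
      + p$(i,l) * (\<Sum>q\<in>UNIV. elementary j k $ q * x $ q) + p$(j,k) * (\<Sum>q\<in>UNIV. elementary i l $ q * x $ q)"
    unfolding quadric_gradient_def sum_distrib_left sum.distrib[symmetric] sum_subtractf[symmetric]
    by (rule sum.cong) (simp_all add: distrib_right left_diff_distrib mult.assoc)
  then show ?thesis
    unfolding pairing_elementary[OF assms] by (simp add: pf4_polar_def algebra_simps)
qed

lemma differential_pf4: "differential (\<lambda>x. pf4 x i j k l) p x = pf4_polar p x i j k l"
proof -
  have "pf4 (p + t *s x) i j k l = pf4 p i j k l + t * pf4_polar p x i j k l + t\<^sup>2 * pf4 x i j k l" for t
    by (simp add: pf4_def pf4_polar_def power2_eq_square algebra_simps)
  then have "((\<lambda>t. pf4 (p + t *s x) i j k l) has_field_derivative pf4_polar p x i j k l) (at 0)"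
    by (auto intro!: derivative_eq_intros)
  then show ?thesis unfolding differential_def by (rule DERIV_imp_deriv)
qed

text \<open>
  One order is chosen for each pair of the remaining indices, because \<open>pf4 i j k l\<close> and \<open>pf4 i j l k\<close>
  agree up to sign on skew arrays.
\<close>

lemma unordered_pairs_of_complement:
  fixes i j :: 6
  assumes "i \<noteq> j"
  obtains P where "card P = 6" "finite P" "\<And>k l. (k, l) \<in> P \<Longrightarrow> k \<notin> {i, j} \<and> l \<notin> {i, j} \<and> (l, k) \<notin> P"
    "\<And>k l. k \<notin> {i, j} \<Longrightarrow> l \<notin> {i, j} \<Longrightarrow> k \<noteq> l \<Longrightarrow> (k, l) \<in> P \<or> (l, k) \<in> P"
proof -
  obtain ks where ks: "set ks = - {i, j}" "distinct ks"
    using finite_distinct_list[of "- {i, j}"] by auto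
  have "length ks = card (- {i, j})" using ks distinct_card by metis
  also have "\<dots> = Suc (Suc (Suc (Suc 0)))" using assms by (simp add: Compl_eq_Diff_UNIV card_Diff_subset)
  finally obtain a b c d where "ks = [a, b, c, d]"
    unfolding length_Suc_conv by blast
  then have abcd: "- {i, j} = {a, b, c, d}" "distinct [a, b, c, d]" using ks by auto
  then have out: "k \<notin> {i, j} \<longleftrightarrow> k \<in> {a, b, c, d}" for k by blast
  show thesis
  proof (rule that[of "{(a, b), (a, c), (a, d), (b, c), (b, d), (c, d)}"])
    show "card {(a, b), (a, c), (a, d), (b, c), (b, d), (c, d)} = 6" using abcd(2) by simp
    show "k \<notin> {i, j} \<and> l \<notin> {i, j} \<and> (l, k) \<notin> {(a, b), (a, c), (a, d), (b, c), (b, d), (c, d)}"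
      if "(k, l) \<in> {(a, b), (a, c), (a, d), (b, c), (b, d), (c, d)}" for k l
      unfolding out using that abcd(2) by auto
    show "(k, l) \<in> {(a, b), (a, c), (a, d), (b, c), (b, d), (c, d)} \<or>
        (l, k) \<in> {(a, b), (a, c), (a, d), (b, c), (b, d), (c, d)}"
      if "k \<notin> {i, j}" "l \<notin> {i, j}" "k \<noteq> l" for k l
      using that unfolding out by auto
  qed simp
qed

text \<open>
  At \<open>p = u \<and> v\<close> with nonzero coordinate i, j the six quadrics of the chart have the right number.
  A linear relation between their differentials on the annihilator of the system says that a
  combination \<open>\<omega>\<close> of these differentials belongs to the system. The quadrics vanish on all
  \<open>u \<and> (v + t y)\<close> and \<open>(u + t y) \<and> v\<close>, so \<open>\<omega>\<close> contracts to zero with u and v, whence \<open>\<omega> = 0\<close>. As the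
  (k, l) entry of \<open>\<omega>\<close> is \<open>p\<^sub>i\<^sub>j\<close> times the coefficient of \<open>pf4 i j k l\<close>, the relation is trivial.
\<close>

theorem smooth_dual_K3: "smooth_of_dim (dual_K3 form_space) 2"
  unfolding dual_K3_def complexify_annihilator smooth_of_dim_def prod.case
proof (intro ballI impI)
  let ?L = "annihilator form_space :: complex array6 set"
  fix p :: "complex array6" assume "p \<in> cone (?L, pluecker_quadrics)" "p \<noteq> 0"
  then have pL: "p \<in> ?L" and quad: "\<forall>F\<in>pluecker_quadrics. F p = 0" by (auto simp: cone_def)
  have Lskew: "?L \<subseteq> skew" by (auto simp: annihilator_def)
  then have "decomposable p" using decomposable_iff_pluecker pL quad by blast
  then obtain u v where uv: "p = wedge u v" by (auto simp: decomposable_def)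
  obtain i j where ij: "p $ (i, j) \<noteq> 0" using \<open>p \<noteq> 0\<close> by (auto simp: vec_eq_iff)
  then have "i \<noteq> j" by (auto simp: uv wedge_def)
  then obtain P where P: "card P = 6" "finite P" "\<And>k l. (k, l) \<in> P \<Longrightarrow> k \<notin> {i, j} \<and> l \<notin> {i, j} \<and> (l, k) \<notin> P"
    "\<And>k l. k \<notin> {i, j} \<Longrightarrow> l \<notin> {i, j} \<Longrightarrow> k \<noteq> l \<Longrightarrow> (k, l) \<in> P \<or> (l, k) \<in> P"
    by (rule unordered_pairs_of_complement) blast
  define Q where "Q = (\<lambda>(k, l) x. pf4 x i j k l :: complex)"
  have inj: "inj_on Q P"
  proof (rule inj_onI, clarify)
    fix k l k' l' assume kl: "(k, l) \<in> P" "(k', l') \<in> P" "Q (k, l) = Q (k', l')"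
    define x :: "complex array6" where "x = (\<chi> q. if q = (i, j) \<or> q = (k, l) then 1 else 0)"
    have ne: "k \<noteq> i" "k \<noteq> j" "l \<noteq> j" "k' \<noteq> j" "l' \<noteq> j" "k' \<noteq> i"
      using P(3)[OF kl(1)] P(3)[OF kl(2)] by blast+
    have "x $ (i, j) = 1" "x $ (i, m) = 0" if "m \<noteq> j" for m
      using that ne by (simp_all add: x_def)
    moreover have "x $ (k, l) = 1" by (simp add: x_def)
    ultimately have "Q (k, l) x = 1" "Q (k', l') x = x $ (k', l')"
      using ne by (simp_all add: Q_def pf4_def)
    then have "x $ (k', l') = 1" using kl(3) by simp
    moreover have "x $ (k', l') = 0" if "(k', l') \<noteq> (k, l)"
      using that ne by (simp add: x_def)
    ultimately show "k = k' \<and> l = l'" by fastforce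
  qed
  have "card (Q ` P) + (2 + 1) = vec.dim ?L"
    by (simp add: card_image[OF inj] P(1) dim_annihilator)
  moreover have "Q ` P \<subseteq> local_ideal ?L pluecker_quadrics p"
  proof (rule image_subsetI, clarify)
    fix k l assume "(k, l) \<in> P"
    have "Q (k, l) \<in> pluecker_quadrics" "Q (k, l) \<in> polyfun"
      using polyfun_pf4 by (auto simp: Q_def pluecker_quadrics_def)
    then show "Q (k, l) \<in> local_ideal ?L pluecker_quadrics p" by (rule in_local_ideal)
  qed
  moreover have "pluecker_quadrics \<subseteq> local_ideal ?L (Q ` P) p"
    by (rule pluecker_chart[OF Lskew P(4) _ ij]) (auto simp: Q_def)
  moreover have "independent_differentials ?L (Q ` P) p"
    unfolding independent_differentials_def
  proof (intro allI impI)
    fix c assume c: "\<forall>x\<in>?L. (\<Sum>g\<in>Q ` P. c g * differential g p x) = 0"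
    define \<omega> where "\<omega> = (\<Sum>(k, l)\<in>P. c (Q (k, l)) *s quadric_gradient p i j k l)"
    have \<omega>skew: "\<omega> \<in> skew"
      unfolding \<omega>_def
      by (rule vec.subspace_sum[OF subspace_skew])
        (auto intro!: vec.subspace_scale[OF subspace_skew] quadric_gradient_skew)
    have pairing: "(\<Sum>q\<in>UNIV. \<omega> $ q * x $ q) = 2 * (\<Sum>(k, l)\<in>P. c (Q (k, l)) * pf4_polar p x i j k l)"
      if "x \<in> skew" for x
    proof -
      have "(\<Sum>q\<in>UNIV. \<omega> $ q * x $ q)
          = (\<Sum>q\<in>UNIV. \<Sum>(k, l)\<in>P. c (Q (k, l)) * (quadric_gradient p i j k l $ q * x $ q))"
        by (simp add: \<omega>_def sum_distrib_right case_prod_unfold mult.assoc)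
      also have "\<dots> = (\<Sum>(k, l)\<in>P. c (Q (k, l)) * (\<Sum>q\<in>UNIV. quadric_gradient p i j k l $ q * x $ q))"
        by (subst sum.swap) (simp add: sum_distrib_left case_prod_unfold)
      finally show ?thesis
        unfolding pairing_quadric_gradient[OF that] sum_distrib_left
        by (simp add: case_prod_unfold mult.left_commute)
    qed
    have "\<omega> \<in> form_space"
    proof (rule form_orthogonal_to_annihilator[OF \<omega>skew])
      fix b :: "complex array6" assume b: "b \<in> ?L"
      have "(\<Sum>g\<in>Q ` P. c g * differential g p b) = (\<Sum>(k, l)\<in>P. c (Q (k, l)) * pf4_polar p b i j k l)"
        by (subst sum.reindex[OF inj]) (auto simp: Q_def differential_pf4 intro!: sum.cong)
      then show "(\<Sum>q\<in>UNIV. \<omega> $ q * b $ q) = 0"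
        using c b pairing[of b] Lskew by auto
    qed
    moreover have tangent: "contract u \<omega> = 0" "contract v \<omega> = 0"
    proof -
      have wedge_skew: "wedge a b \<in> skew" for a b :: "complex ^ 6"
        by (simp add: skew_def wedge_def)
      have "contract a \<omega> $ k = 0" if a: "\<And>y k l. pf4_polar p (wedge a y) i j k l = 0" for a k
      proof -
        have "2 * (\<Sum>j\<in>UNIV. contract a \<omega> $ j * axis k 1 $ j) = 0"
          unfolding pairing_wedge[OF \<omega>skew, symmetric] pairing[OF wedge_skew] a by simp
        moreover have "(\<Sum>j\<in>UNIV. contract a \<omega> $ j * axis k 1 $ j) = (\<Sum>j\<in>UNIV. if j = k then contract a \<omega> $ k else 0)"
          by (rule sum.cong) (auto simp: axis_component)
        ultimately show ?thesis by simp
      qed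
      moreover have "pf4_polar p (wedge u y) i j k l = 0" "pf4_polar p (wedge v y) i j k l = 0" for y k l
        by (simp_all add: uv pf4_polar_def wedge_def algebra_simps)
      ultimately show "contract u \<omega> = 0" "contract v \<omega> = 0" by (simp_all add: vec_eq_iff)
    qed
    ultimately have "\<omega> = 0"
      using no_kernel_plane[of \<omega> u v] \<open>p \<noteq> 0\<close> pL uv by blast
    show "\<forall>g\<in>Q ` P. c g = 0"
    proof (intro ballI, clarify)
      fix k l assume kl: "(k, l) \<in> P"
      have "\<omega> $ (k, l) = (\<Sum>(k', l')\<in>P. c (Q (k', l')) * quadric_gradient p i j k' l' $ (k, l))"
        by (simp add: \<omega>_def case_prod_unfold)
      also have "\<dots> = (\<Sum>q\<in>P. if q = (k, l) then c (Q (k, l)) * p $ (i, j) else 0)"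
      proof (rule sum.cong[OF refl], clarify)
        fix k' l' assume kl': "(k', l') \<in> P"
        have ne: "k \<noteq> i" "k \<noteq> j" "l \<noteq> i" "l \<noteq> j" "(k', l') \<noteq> (l, k)"
          using P(3)[OF kl] kl' by blast+
        have "k \<noteq> l" using P(3)[OF kl] kl by blast
        have "quadric_gradient p i j k' l' $ (k, l) = p $ (i, j) * elementary k' l' $ (k, l)"
          using ne(1-4) by (simp add: quadric_gradient_def elementary_nth axis_component)
        also have "elementary k' l' $ (k, l) = (if (k', l') = (k, l) then 1 else 0 :: complex)"
        proof (cases "(k', l') = (k, l)")
          case True
          then show ?thesis using \<open>k \<noteq> l\<close> by (simp add: elementary_nth axis_component)
        next
          case False
          then have "axis k' 1 $ k * axis l' 1 $ l = (0 :: complex)"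
            by (auto simp: axis_component)
          moreover have "axis k' 1 $ l * axis l' 1 $ k = (0 :: complex)"
            using ne(5) by (auto simp: axis_component)
          ultimately show ?thesis using False by (simp only: elementary_nth) simp
        qed
        finally show "c (Q (k', l')) * quadric_gradient p i j k' l' $ (k, l)
            = (if (k', l') = (k, l) then c (Q (k, l)) * p $ (i, j) else 0)"
          by (cases "(k', l') = (k, l)") auto
      qed
      also have "\<dots> = c (Q (k, l)) * p $ (i, j)" using kl P(2) by simp
      finally show "c (Q (k, l)) = 0" using ij \<open>\<omega> = 0\<close> by simp
    qed
  qed
  ultimately show "\<exists>G. finite G \<and> card G + (2 + 1) = vec.dim ?L \<and>
      G \<subseteq> local_ideal ?L pluecker_quadrics p \<and> pluecker_quadrics \<subseteq> local_ideal ?L G p \<and>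
      independent_differentials ?L G p"
    using P(2) by (intro exI[of _ "Q ` P"]) auto
qed

section \<open>Lines on the K3 surface\<close>

text \<open>
  Two decomposable bivectors with decomposable sum share a vector. As \<open>b'\<^sub>i\<^sub>j = 0\<close>, the rows i and j of
  \<open>b'\<close> are proportional, with factors \<open>\<alpha>\<close>, \<open>\<beta>\<close> to a common row c; the Pluecker relations of b and of the
  sum then exhibit \<open>\<beta> b\<^sub>i - \<alpha> b\<^sub>j\<close> as the common vector, \<open>b\<^sub>i\<close> being row i of b.
\<close>

lemma common_vector:
  fixes b b' :: "complex array6"
  assumes pl: "\<And>i j k l. pf4 b i j k l = 0" "\<And>i j k l. pf4 b' i j k l = 0"
      "\<And>i j k l. pf4 (b + b') i j k l = 0"
    and skew: "b \<in> skew" "b' \<in> skew"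
    and ij: "b $ (i, j) \<noteq> 0" "b' $ (i, j) = 0"
  shows "\<exists>u y y'. wedge u y = b $ (i, j) *s b \<and> wedge u y' = b $ (i, j) *s b'"
proof -
  have polar: "b$(i,j) * b'$(k,l) = b$(i,k) * b'$(j,l) + b'$(i,k) * b$(j,l) - b$(i,l) * b'$(j,k) - b'$(i,l) * b$(j,k)"
    for k l
    using pl(1)[of i j k l] pl(2)[of i j k l] pl(3)[of i j k l] ij(2)
    unfolding pf4_def vector_add_component by algebra
  have minor: "b'$(i,k) * b'$(j,l) = b'$(i,l) * b'$(j,k)" for k l
    using pl(2)[of i j k l] ij(2) by (simp add: pf4_def)
  have "\<exists>\<alpha> \<beta> c. (\<alpha> \<noteq> 0 \<or> \<beta> \<noteq> 0) \<and> (\<forall>k. b'$(i,k) = \<alpha> * c k \<and> b'$(j,k) = \<beta> * c k)"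
  proof (cases "\<exists>m. b'$(i,m) \<noteq> 0")
    case True
    then obtain m where m: "b'$(i,m) \<noteq> 0" by blast
    define \<beta> where "\<beta> = b'$(j,m) / b'$(i,m)"
    have "b'$(j,k) = \<beta> * b'$(i,k)" for k
      using minor[of m k] m by (simp add: \<beta>_def field_simps)
    then have "\<forall>k. b'$(i,k) = 1 * b'$(i,k) \<and> b'$(j,k) = \<beta> * b'$(i,k)" by auto
    then show ?thesis
      by (intro exI[of _ 1] exI[of _ \<beta>] exI[of _ "\<lambda>k. b'$(i,k)"] conjI disjI1 one_neq_zero)
  next
    case False
    then show ?thesis
      by (intro exI[of _ 0] exI[of _ 1] exI[of _ "\<lambda>k. b'$(j,k)"]) simp
  qed
  then obtain \<alpha> \<beta> c where ab: "\<alpha> \<noteq> 0 \<or> \<beta> \<noteq> 0" and c: "\<And>k. b'$(i,k) = \<alpha> * c k" "\<And>k. b'$(j,k) = \<beta> * c k"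
    by blast
  define u where "u = (\<chi> k. \<beta> * b$(i,k) - \<alpha> * b$(j,k))"
  define y where "y = (\<chi> k. if \<beta> \<noteq> 0 then b$(j,k) / \<beta> else b$(i,k) / \<alpha>)"
  define y' where "y' = (\<chi> k. c k)"
  have "wedge u y $ (k, l) = b$(i,j) * b$(k,l)" for k l
  proof -
    have "b$(i,j) * b$(k,l) = b$(i,k) * b$(j,l) - b$(i,l) * b$(j,k)"
      using pl(1)[of i j k l] by (simp add: pf4_def algebra_simps)
    moreover have "wedge u y $ (k, l) = b$(i,k) * b$(j,l) - b$(i,l) * b$(j,k)"
      using ab by (cases "\<beta> = 0") (simp_all add: wedge_def u_def y_def field_simps)
    ultimately show ?thesis by simp
  qed
  moreover have "wedge u y' $ (k, l) = b$(i,j) * b'$(k,l)" for k l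
    unfolding polar c by (simp add: wedge_def u_def y'_def algebra_simps)
  ultimately show ?thesis
    by (intro exI[of _ u] exI[of _ y] exI[of _ y']) (simp add: vec_eq_iff)
qed

lemma dim_kernels_ge:
  fixes M :: "('a::field ^ 'n::finite) set" and \<phi> :: "'d \<Rightarrow> 'a ^ 'n \<Rightarrow> 'a"
  assumes "finite D" and M: "vec.subspace M"
    and add: "\<And>d x y. \<phi> d (x + y) = \<phi> d x + \<phi> d y" and scale: "\<And>d c x. \<phi> d (c *s x) = c * \<phi> d x"
  shows "vec.subspace {m\<in>M. \<forall>d\<in>D. \<phi> d m = 0} \<and>
    vec.dim M \<le> vec.dim {m\<in>M. \<forall>d\<in>D. \<phi> d m = 0} + card D"
  using \<open>finite D\<close>
proof (induction D)
  case empty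
  then show ?case using M by simp
next
  case (insert d D)
  let ?K = "{m\<in>M. \<forall>d\<in>D. \<phi> d m = 0}"
  have "{m\<in>M. \<forall>d\<in>insert d D. \<phi> d m = 0} = {m\<in>?K. \<phi> d m = 0}" by auto
  then show ?case
    using dim_kernel_ge[of ?K "\<phi> d", OF _ add scale] insert by auto
qed

lemma independent_wedge_triple:
  fixes u y y' :: "complex ^ 6"
  assumes ind: "\<And>s t. s *s wedge u y + t *s wedge u y' = 0 \<Longrightarrow> s = 0 \<and> t = 0"
  shows "vec.independent {u, y, y'} \<and> card {u, y, y'} = 3"
proof -
  have wu: "wedge u u = 0" "wedge u 0 = 0" "wedge 0 y = 0" by (simp_all add: wedge_def vec_eq_iff mult.commute)
  have lin: "wedge u (s *s y + t *s y') = s *s wedge u y + t *s wedge u y'" for s t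
    by (simp add: wedge_def vec_eq_iff algebra_simps)
  have sp: "x \<in> vec.span {y, y'} \<Longrightarrow> \<exists>s t. x = s *s y + t *s y'" for x
  proof -
    assume "x \<in> vec.span {y, y'}"
    then obtain s t where "x - s *s y - t *s y' = 0"
      by (auto simp: vec.span_breakdown_eq)
    then show "\<exists>s t. x = s *s y + t *s y'" by (intro exI[of _ s] exI[of _ t]) (simp add: algebra_simps)
  qed
  have y': "y' \<noteq> 0" using ind[of 0 1] wu by auto
  have y: "y \<notin> vec.span {y'}"
  proof
    assume "y \<in> vec.span {y'}"
    then obtain t where "y - t *s y' = 0" by (auto simp: vec.span_breakdown_eq)
    then have "wedge u (1 *s y + (- t) *s y') = 0" using wu by simp
    then show False using ind[of 1 "- t"] unfolding lin by simp
  qed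
  have u: "u \<notin> vec.span {y, y'}"
  proof
    assume "u \<in> vec.span {y, y'}"
    then obtain s t where st: "u = s *s y + t *s y'" using sp by blast
    then have "s *s wedge u y + t *s wedge u y' = 0" using lin[of s t] wu by simp
    then have "u = 0" using ind[of s t] st by simp
    then show False using ind[of 1 0] wu by simp
  qed
  have "vec.independent {u, y, y'}"
    using u y y' by (simp add: vec.independent_insert vec.span_base)
  moreover have "y \<noteq> y'" "u \<noteq> y" "u \<noteq> y'" using y u vec.span_base by blast+
  ultimately show ?thesis by simp
qed

text \<open>
  A line on the K3 surface consists of the bivectors \<open>u \<and> d\<close> with d in the span of y and y'. Every form
  of the system is orthogonal to it, so its contraction with u vanishes on u, y and y'. Three further
  linear conditions make this contraction zero, and what remains of the six-dimensional system is a
  space of dimension at least three of degenerate forms: a plane on the fourfold.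
\<close>

theorem no_line_dual_K3: "\<not> contains_line (dual_K3 form_space)"
proof
  assume "contains_line (dual_K3 form_space)"
  then obtain M :: "complex array6 set" where M: "vec.subspace M" "vec.dim M = 2"
    and cone: "M \<subseteq> cone (annihilator form_space, pluecker_quadrics)"
    by (auto simp: contains_linear_space_def dual_K3_def complexify_annihilator)
  have ann: "M \<subseteq> annihilator form_space" using cone by (auto simp: cone_def)
  have pl: "pf4 b i j k l = 0" if "b \<in> M" for b i j k l
  proof -
    have "(\<lambda>x. pf4 x i j k l) \<in> pluecker_quadrics" by (auto simp: pluecker_quadrics_def)
    then show ?thesis using cone that by (auto simp: cone_def)
  qed
  have skew: "M \<subseteq> skew" using ann by (auto simp: annihilator_def)
  obtain b where b: "b \<in> M" "b \<noteq> 0" using dim_pos_nonzero[of M] M by auto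
  obtain i j where ij: "b $ (i, j) \<noteq> 0" using b by (auto simp: vec_eq_iff)
  have "vec.dim M \<le> vec.dim {m\<in>M. m $ (i, j) = 0} + 1"
    using dim_kernel_ge[OF M(1), of "\<lambda>m. m $ (i, j)"] by simp
  then have "0 < vec.dim {m\<in>M. m $ (i, j) = 0}" using M(2) by linarith
  then obtain b' where b': "b' \<in> M" "b' \<noteq> 0" "b' $ (i, j) = 0"
    using dim_pos_nonzero by blast
  have "b + b' \<in> M" using b b' M vec.subspace_add by blast
  then obtain u y y' where uy: "wedge u y = b $ (i, j) *s b" "wedge u y' = b $ (i, j) *s b'"
    using common_vector[of b b' i j] pl b b' skew ij by blast
  have "s = 0 \<and> t = 0" if "s *s wedge u y + t *s wedge u y' = 0" for s t
  proof -
    have e: "s * (b $ (i, j) * b $ q) + t * (b $ (i, j) * b' $ q) = 0" for q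
      using arg_cong[OF that, of "\<lambda>x. x $ q"] by (simp add: uy mult.assoc)
    have "s = 0" using e[of "(i, j)"] ij b' by simp
    moreover obtain q where "b' $ q \<noteq> 0" using b' by (auto simp: vec_eq_iff)
    ultimately show ?thesis using e[of q] ij by simp
  qed
  then have "vec.independent {u, y, y'}" and card3: "card {u, y, y'} = 3"
    using independent_wedge_triple by blast+
  then obtain B where B: "{u, y, y'} \<subseteq> B" "vec.independent B" "UNIV \<subseteq> vec.span B"
    using vec.maximal_independent_subset_extend[of "{u, y, y'}" UNIV] by auto
  have cardB: "card B = 6"
    using vec.dim_unique[OF subset_UNIV B(3,2)] by (simp add: vec_dim_card del: vec.dim_UNIV)
  have finB: "finite B" using vec.finiteI_independent B by blast
  \<comment> \<open>vectors completing u, y, y' to a basis give the three conditions\<close>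
  define D where "D = B - {u, y, y'}"
  have D: "finite D" "card D = 3"
    using B cardB finB card3 by (auto simp: D_def card_Diff_subset)
  let ?\<phi> = "\<lambda>d \<eta>. \<Sum>j\<in>UNIV. contract u \<eta> $ j * d $ j"
  define K where "K = {\<eta>\<in>form_space. \<forall>d\<in>D. ?\<phi> d \<eta> = (0::complex)}"
  have add: "?\<phi> d (x + z) = ?\<phi> d x + ?\<phi> d z" and scale: "?\<phi> d (c *s x) = c * ?\<phi> d x" for d c and x z :: "complex array6"
    by (simp_all add: contract_def algebra_simps sum.distrib sum_distrib_left)
  have K: "vec.subspace K" "vec.dim K \<ge> 3"
    using dim_kernels_ge[OF D(1) subspace_form_space, of ?\<phi>, OF add scale] D(2)
    by (auto simp: K_def dim_form_space)
  have "contract u \<eta> = 0" if \<eta>: "\<eta> \<in> K" for \<eta>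
  proof -
    have form: "\<eta> \<in> form_space" using \<eta> by (simp add: K_def)
    have orth: "?\<phi> d \<eta> = 0" if "wedge u d \<in> annihilator form_space" for d
    proof -
      have "(\<Sum>p\<in>UNIV. \<eta> $ p * wedge u d $ p) = 0" using that form by (auto simp: annihilator_def)
      then show ?thesis using form by (simp add: pairing_wedge form_space_skew)
    qed
    have "wedge u d \<in> annihilator form_space" if "d \<in> {u, y, y'}" for d
    proof -
      have "wedge u u = 0" by (simp add: wedge_def vec_eq_iff)
      then have "wedge u d \<in> M" using that b b' M vec.subspace_scale vec.subspace_0 by (auto simp: uy)
      then show ?thesis using ann by blast
    qed
    then have "?\<phi> d \<eta> = 0" if "d \<in> B" for d
      using orth \<eta> that by (cases "d \<in> D") (auto simp: K_def D_def)
    moreover have "vec.subspace {d. ?\<phi> d \<eta> = 0}"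
      by (auto simp: vec.subspace_def algebra_simps sum.distrib sum_distrib_left[symmetric])
    ultimately have "vec.span B \<subseteq> {d. ?\<phi> d \<eta> = 0}" by (intro vec.span_minimal) auto
    then have all: "?\<phi> d \<eta> = 0" for d using B(3) by blast
    have "contract u \<eta> $ k = 0" for k
    proof -
      have "?\<phi> (axis k 1) \<eta> = (\<Sum>j\<in>UNIV. if j = k then contract u \<eta> $ k else 0)"
        by (rule sum.cong) (auto simp: axis_component)
      then show ?thesis using all[of "axis k 1"] by simp
    qed
    then show ?thesis by (simp add: vec_eq_iff)
  qed
  moreover have "u \<noteq> 0"
  proof
    assume "u = 0"
    then have "wedge u y = 0" by (simp add: wedge_def vec_eq_iff)
    then show False using uy ij b by (auto simp: vec_eq_iff)
  qed
  ultimately have "degenerate \<eta>" if "\<eta> \<in> K" for \<eta>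
    using that unfolding degenerate_def contract_def vec_eq_iff vec_lambda_beta zero_index by blast
  then have "pf \<eta> = 0" if "\<eta> \<in> K" for \<eta>
    using that degenerate_iff_pf form_space_skew by (auto simp: K_def)
  then have "vec.dim K \<le> 2"
    using K(1) by (intro fourfold_linear_subspace) (auto simp: K_def)
  then show False using K(2) by simp
qed

theorem proposition5p1:
  shows "\<exists>Z W. pfaffian_flag Z W
           \<and> smooth_of_dim (pfaffian_cubic Z) 3
           \<and> smooth_of_dim (pfaffian_cubic W) 4
           \<and> \<not> contains_plane (pfaffian_cubic W)
           \<and> cyclic_triple_cover Z W
           \<and> smooth_of_dim (dual_K3 W) 2
           \<and> \<not> contains_line (dual_K3 W)"
  by (intro exI[of _ form_hyperplane] exI[of _ form_space] conjI pfaffian_flag_forms smooth_threefold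
      smooth_fourfold no_plane_fourfold cyclic_triple_cover_forms smooth_dual_K3 no_line_dual_K3)

end
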